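(* For all integers $1\le n \leq m$ the pair $(\ell_{\phi_{\theta, n}}, \ell_{\phi_{\theta, m}})$ has the $C([0,1], \mathbb{C})$-extension property: every bounded linear operator $T:\ell_{\phi_{\theta,n}}\to C([0,1],\mathbb{C})$ admits a bounded linear extension to $\ell_{\phi_{\theta,m}}$, where $\ell_{\phi_{\theta,n}}$ is regarded as a subspace of $\ell_{\phi_{\theta,m}}$ through the embedding $(x_{n-1},\dots,x_0)\mapsto(x_{n-1},\dots,x_0,0,\dots,0)$.
   Context: **Extension property.** If $X$ is a complex Banach space (or a quasi-Banach space whose quasinorm is equivalent to a norm) and $Y$ is a subspace of $X$, the pair $(Y,X)$ has the $C([0,1],\mathbb{C})$-extension property if every bounded linear operator $T:Y\to C([0,1],\mathbb{C})$ admits a bounded linear extension to $X$. **Young and quasi-Young functions.** A function $\phi:\mathbb{C}^n\to[0,\infty)$ is quasi-Young if $\phi(0)=0$, $\lim_{t\to\infty}\phi(tx)=\infty$ for every $x\neq 0$, $\phi(e^{is}x)=\phi(x)$ for all $x\in\mathbb{C}^n$, $s\in\mathbb{R}$, and there is $C>0$ with $\phi(tx+(1-t)y)\le C(t\phi(x)+(1-t)\phi(y))$ for all $x,y\in\mathbb{C}^n$, $t\in[0,1]$. It is a Young function if it is convex (and has the other three properties). The Fenchel-Orlicz space is $\ell_\phi=\{(x^k)_k\in(\mathbb{C}^n)^{\mathbb{N}}:\exists\rho>0,\ \sum_k\phi(x^k/\rho)<\infty\}$ with $\|(x^k)\|_\phi=\inf\{\rho>0:\sum_k\phi(x^k/\rho)\le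 1\}$, a complete quasinorm equivalent to a norm. An element of $(\mathbb{C}^n)^{\mathbb{N}}$ is also written as an $n$-tuple $(x_{n-1},\dots,x_0)$ of scalar sequences. An Orlicz function is a Young function on $\mathbb{C}$; it satisfies $\phi(x)=\phi(|x|)$ and so is determined by its values on $[0,\infty)$. It is nondegenerate if $\phi(t)>0$ for $t>0$; then $\phi^{-1}$ denotes the inverse of $\phi|_{[0,\infty)}$. $\phi$ satisfies $\Delta_2$ if there is $M>0$ with $\phi(2x)\le M\phi(x)$ for all $x$. **Setting.** $\phi_0,\phi_1$ are nondegenerate Orlicz functions satisfying $\Delta_2$; it is also allowed that the space $\ell_{\phi_0}$ is replaced by $\ell_\infty$ or $c_0$, in which case $\phi_0^{-1}$ is taken to be the constant function $1$. $\theta\in(0,1)$ is fixed and $\phi_\theta$ is the Orlicz function given by $\phi_\theta^{-1}=(\phi_0^{-1})^{1-\theta}(\phi_1^{-1})^{\theta}$ on $[0,\infty)$. **The functions $\phi_{\theta,n}$.** Let $\mathbb{S}=\{z\in\mathbb{C}:0\le \mathrm{Re}(z)\le 1\}$ with interior $\mathbb{S}^{\mathrm o}$, and let $\varphi:\mathbb{S}\to\overline{\mathbb{D}}$ be a conformal map (continuous on $\mathbb{S}$, conformal from $\mathbb{S}^{\mathrm o}$ onto the open unit disk $\mathbb{D}$) with $\varphi(\theta)=0$. For a function $f$, $\hat f[j;z]=f^{(j)}(z)/j!$. Let $\mathrm{sgn}(z)=z/|z|$ for $z\ne0$, $\mathrm{sgn}(0)=0$. For $x\in\mathbb{C}$ put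 $g_x(z)=\phi_0^{-1}(\phi_\theta(|x|))^{1-z}\,\phi_1^{-1}(\phi_\theta(|x|))^{z}\,\mathrm{sgn}(x)$, $z\in\mathbb{S}$ (so $g_0\equiv 0$). For $n\ge2$ and $x=(x_{n-1},\dots,x_0)\in\mathbb{C}^n$ put $$g_x(z)=g_{(x_{n-2},\dots,x_0)}(z)+\frac{\varphi(z)^{n-1}}{k_n}\,g_{\,n!\,(x_{n-1}-\hat g_{(x_{n-2},\dots,x_0)}[n-1;\theta])}(z),\qquad k_n=n!\,\varphi'(\theta)^{n-1},$$ so that $\hat g_x[j;\theta]=x_j$ for $0\le j\le n-1$. Let $\phi_{\theta,1}=\phi_\theta$ and, for $n\ge2$, $$\phi_{\theta,n}(x_{n-1},\dots,x_0)=\phi_{\theta,n-1}(x_{n-2},\dots,x_0)+\phi_\theta\big(x_{n-1}-\hat g_{(x_{n-2},\dots,x_0)}[n-1;\theta]\big).$$ The functions $\phi_{\theta,n}$ are quasi-Young. *)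

theory Defs
  imports "HOL-Complex_Analysis.Complex_Analysis"
begin

section \<open>Orlicz functions\<close>

definition orlicz :: "(complex \<Rightarrow> real) \<Rightarrow> bool" where
  "orlicz \<phi> \<longleftrightarrow>
     (\<forall>x. 0 \<le> \<phi> x) \<and> \<phi> 0 = 0 \<and>
     (\<forall>x. x \<noteq> 0 \<longrightarrow> filterlim (\<lambda>t::real. \<phi> (of_real t * x)) at_top at_top) \<and>
     (\<forall>x (s::real). \<phi> (exp (\<i> * of_real s) * x) = \<phi> x) \<and>
     convex_on UNIV \<phi>"

definition nondegenerate :: "(complex \<Rightarrow> real) \<Rightarrow> bool" where
  "nondegenerate \<phi> \<longleftrightarrow> (\<forall>t::real. t > 0 \<longrightarrow> \<phi> (of_real t) > 0)"

definition Delta2 :: "(complex \<Rightarrow> real) \<Rightarrow> bool" where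
  "Delta2 \<phi> \<longleftrightarrow> (\<exists>M>0. \<forall>x. \<phi> (2 * x) \<le> M * \<phi> x)"

definition orlicz_inv :: "(complex \<Rightarrow> real) \<Rightarrow> real \<Rightarrow> real" where
  "orlicz_inv \<phi> = the_inv_into {0..} (\<lambda>t. \<phi> (of_real t))"

text \<open>The left endpoint of the interpolation couple: an Orlicz space, or one of the
  two spaces allowed in its place, for which the inverse function is replaced by 1.\<close>

datatype endpoint = Orlicz_space "complex \<Rightarrow> real" | Ell_infty | C_zero

primrec admissible_endpoint :: "endpoint \<Rightarrow> bool" where
  "admissible_endpoint (Orlicz_space \<phi>) \<longleftrightarrow> orlicz \<phi> \<and> nondegenerate \<phi> \<and> Delta2 \<phi>"
| "admissible_endpoint Ell_infty \<longleftrightarrow> True"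
| "admissible_endpoint C_zero \<longleftrightarrow> True"

primrec endpoint_inv :: "endpoint \<Rightarrow> real \<Rightarrow> real" where
  "endpoint_inv (Orlicz_space \<phi>) = orlicz_inv \<phi>"
| "endpoint_inv Ell_infty = (\<lambda>_. 1)"
| "endpoint_inv C_zero = (\<lambda>_. 1)"

text \<open>Below, \<open>\<psi>0\<close> and \<open>\<psi>1\<close> stand for the inverse functions of the two endpoints. The function
  \<open>phi_theta\<close> is radial, and on the nonnegative half-line it is the inverse of
  \<open>\<psi>0 powr (1 - \<theta>) * \<psi>1 powr \<theta>\<close>.\<close>

definition phi_theta ::
    "(real \<Rightarrow> real) \<Rightarrow> (real \<Rightarrow> real) \<Rightarrow> real \<Rightarrow> complex \<Rightarrow> real" where
  "phi_theta \<psi>0 \<psi>1 \<theta> x =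
     the_inv_into {0..} (\<lambda>u. \<psi>0 u powr (1 - \<theta>) * \<psi>1 u powr \<theta>) (cmod x)"


section \<open>The functions \<open>\<phi>\<^bsub>\<theta>,n\<^esub>\<close>\<close>

definition strip :: "complex set" where
  "strip = {z. 0 \<le> Re z \<and> Re z \<le> 1}"

definition conformal_strip_map :: "real \<Rightarrow> (complex \<Rightarrow> complex) \<Rightarrow> bool" where
  "conformal_strip_map \<theta> w \<longleftrightarrow>
     continuous_on strip w \<and> w ` strip \<subseteq> cball 0 1 \<and>
     w holomorphic_on interior strip \<and>
     bij_betw w (interior strip) (ball 0 1) \<and>
     w (of_real \<theta>) = 0"

definition taylor_coeff :: "(complex \<Rightarrow> complex) \<Rightarrow> nat \<Rightarrow> complex \<Rightarrow> complex" where
  "taylor_coeff f j z = (deriv ^^ j) f z / fact j"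

definition g_scalar ::
    "(real \<Rightarrow> real) \<Rightarrow> (real \<Rightarrow> real) \<Rightarrow> real \<Rightarrow> complex \<Rightarrow> complex \<Rightarrow> complex" where
  "g_scalar \<psi>0 \<psi>1 \<theta> x = (\<lambda>z.
     complex_of_real (\<psi>0 (phi_theta \<psi>0 \<psi>1 \<theta> x)) powr (1 - z) *
     complex_of_real (\<psi>1 (phi_theta \<psi>0 \<psi>1 \<theta> x)) powr z * sgn x)"

text \<open>A vector \<open>(x\<^bsub>n-1\<^esub>, \<dots>, x\<^bsub>0\<^esub>)\<close> of \<open>\<complex>\<^sup>n\<close> is encoded by a function \<open>x :: nat \<Rightarrow> complex\<close> with
  \<open>x j = x\<^bsub>j\<^esub>\<close> for \<open>j < n\<close> and \<open>x j = 0\<close> otherwise. The functions indexed by \<open>n\<close> below only look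
  at the coordinates \<open>j < n\<close>, so the passage from \<open>(x\<^bsub>n-1\<^esub>, \<dots>, x\<^bsub>0\<^esub>)\<close> to \<open>(x\<^bsub>n-2\<^esub>, \<dots>, x\<^bsub>0\<^esub>)\<close>
  just lowers the index. The value at \<open>n = 0\<close> is a dummy. The conformal map is \<open>w\<close>, and the
  denominator in the recursion is \<open>k\<^bsub>n\<^esub> = n! w'(\<theta>)\<^bsup>n-1\<^esup>\<close>, taken at \<open>n + 2\<close>.\<close>

fun g_vec ::
    "(real \<Rightarrow> real) \<Rightarrow> (real \<Rightarrow> real) \<Rightarrow> real \<Rightarrow> (complex \<Rightarrow> complex) \<Rightarrow>
     nat \<Rightarrow> (nat \<Rightarrow> complex) \<Rightarrow> complex \<Rightarrow> complex" where
  "g_vec \<psi>0 \<psi>1 \<theta> w 0 x = (\<lambda>z. 0)"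
| "g_vec \<psi>0 \<psi>1 \<theta> w (Suc 0) x = g_scalar \<psi>0 \<psi>1 \<theta> (x 0)"
| "g_vec \<psi>0 \<psi>1 \<theta> w (Suc (Suc n)) x = (\<lambda>z.
     g_vec \<psi>0 \<psi>1 \<theta> w (Suc n) x z +
     w z ^ Suc n / (fact (Suc (Suc n)) * deriv w (of_real \<theta>) ^ Suc n) *
     g_scalar \<psi>0 \<psi>1 \<theta>
       (fact (Suc (Suc n)) *
        (x (Suc n) - taylor_coeff (g_vec \<psi>0 \<psi>1 \<theta> w (Suc n) x) (Suc n) (of_real \<theta>))) z)"

fun phi_vec ::
    "(real \<Rightarrow> real) \<Rightarrow> (real \<Rightarrow> real) \<Rightarrow> real \<Rightarrow> (complex \<Rightarrow> complex) \<Rightarrow>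
     nat \<Rightarrow> (nat \<Rightarrow> complex) \<Rightarrow> real" where
  "phi_vec \<psi>0 \<psi>1 \<theta> w 0 x = 0"
| "phi_vec \<psi>0 \<psi>1 \<theta> w (Suc 0) x = phi_theta \<psi>0 \<psi>1 \<theta> (x 0)"
| "phi_vec \<psi>0 \<psi>1 \<theta> w (Suc (Suc n)) x =
     phi_vec \<psi>0 \<psi>1 \<theta> w (Suc n) x +
     phi_theta \<psi>0 \<psi>1 \<theta>
       (x (Suc n) - taylor_coeff (g_vec \<psi>0 \<psi>1 \<theta> w (Suc n) x) (Suc n) (of_real \<theta>))"


section \<open>Fenchel--Orlicz spaces\<close>

text \<open>In an element \<open>X\<close> of \<open>(\<complex>\<^sup>n)\<^sup>\<nat>\<close>, the scalar \<open>X k j\<close> is the coordinate with subscript \<open>j\<close>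
  of the \<open>k\<close>-th term.\<close>

type_synonym vseq = "nat \<Rightarrow> nat \<Rightarrow> complex"

definition fenchel_orlicz :: "nat \<Rightarrow> ((nat \<Rightarrow> complex) \<Rightarrow> real) \<Rightarrow> vseq set" where
  "fenchel_orlicz n \<phi> =
     {X. (\<forall>k. \<forall>j\<ge>n. X k j = 0) \<and>
         (\<exists>\<rho>>0. summable (\<lambda>k. \<phi> (\<lambda>j. X k j / complex_of_real \<rho>)))}"

definition luxemburg :: "((nat \<Rightarrow> complex) \<Rightarrow> real) \<Rightarrow> vseq \<Rightarrow> real" where
  "luxemburg \<phi> X =
     Inf {\<rho>. \<rho> > 0 \<and> summable (\<lambda>k. \<phi> (\<lambda>j. X k j / complex_of_real \<rho>)) \<and>
             (\<Sum>k. \<phi> (\<lambda>j. X k j / complex_of_real \<rho>)) \<le> 1}"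

text \<open>The embedding \<open>(x\<^bsub>n-1\<^esub>, \<dots>, x\<^bsub>0\<^esub>) \<mapsto> (x\<^bsub>n-1\<^esub>, \<dots>, x\<^bsub>0\<^esub>, 0, \<dots>, 0)\<close>. Coordinates are numbered
  from the right, so it raises subscripts by \<open>m - n\<close>.\<close>

definition tuple_embed :: "nat \<Rightarrow> nat \<Rightarrow> vseq \<Rightarrow> vseq" where
  "tuple_embed n m X = (\<lambda>k j. if m - n \<le> j \<and> j < m then X k (j - (m - n)) else 0)"


section \<open>The extension property\<close>

text \<open>Elements of \<open>C([0,1],\<complex>)\<close> are represented by functions on the reals that are continuous on
  \<open>{0..1}\<close>; their values elsewhere are irrelevant, so equations between them are required on
  \<open>{0..1}\<close> only.\<close>

definition sup_norm01 :: "(real \<Rightarrow> complex) \<Rightarrow> real" where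
  "sup_norm01 f = (SUP t\<in>{0..1}. cmod (f t))"

definition bounded_operator_C01 ::
    "vseq set \<Rightarrow> (vseq \<Rightarrow> real) \<Rightarrow> (vseq \<Rightarrow> real \<Rightarrow> complex) \<Rightarrow> bool" where
  "bounded_operator_C01 E N T \<longleftrightarrow>
     (\<forall>X\<in>E. continuous_on {0..1} (T X)) \<and>
     (\<forall>X\<in>E. \<forall>Y\<in>E. \<forall>t\<in>{0..1}. T (\<lambda>k j. X k j + Y k j) t = T X t + T Y t) \<and>
     (\<forall>c. \<forall>X\<in>E. \<forall>t\<in>{0..1}. T (\<lambda>k j. c * X k j) t = c * T X t) \<and>
     (\<exists>K. \<forall>X\<in>E. sup_norm01 (T X) \<le> K * N X)"

text \<open>\<open>Y\<close>, with quasinorm \<open>NY\<close>, is a subspace of \<open>X\<close>, with quasinorm \<open>NX\<close>, via the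
  linear map \<open>\<iota>\<close>, up to equivalence of quasinorms.\<close>

definition subspace_via ::
    "vseq set \<Rightarrow> (vseq \<Rightarrow> real) \<Rightarrow> vseq set \<Rightarrow> (vseq \<Rightarrow> real) \<Rightarrow> (vseq \<Rightarrow> vseq) \<Rightarrow> bool" where
  "subspace_via Y NY X NX \<iota> \<longleftrightarrow>
     (\<forall>y\<in>Y. \<iota> y \<in> X) \<and>
     (\<forall>y\<in>Y. \<forall>y'\<in>Y. \<iota> (\<lambda>k j. y k j + y' k j) = (\<lambda>k j. \<iota> y k j + \<iota> y' k j)) \<and>
     (\<forall>c. \<forall>y\<in>Y. \<iota> (\<lambda>k j. c * y k j) = (\<lambda>k j. c * \<iota> y k j)) \<and>
     (\<exists>a>0. \<exists>b>0. \<forall>y\<in>Y. a * NY y \<le> NX (\<iota> y) \<and> NX (\<iota> y) \<le> b * NY y)"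

definition C01_extension_property ::
    "vseq set \<Rightarrow> (vseq \<Rightarrow> real) \<Rightarrow> vseq set \<Rightarrow> (vseq \<Rightarrow> real) \<Rightarrow> (vseq \<Rightarrow> vseq) \<Rightarrow> bool" where
  "C01_extension_property Y NY X NX \<iota> \<longleftrightarrow>
     subspace_via Y NY X NX \<iota> \<and>
     (\<forall>T. bounded_operator_C01 Y NY T \<longrightarrow>
        (\<exists>S. bounded_operator_C01 X NX S \<and> (\<forall>y\<in>Y. \<forall>t\<in>{0..1}. S (\<iota> y) t = T y t)))"

end

theory Submission
  imports Defs
begin

text \<open>
  Evaluating an operator at \<open>t\<close> and restricting it to the \<open>k\<close>-th coordinate gives functionals
  \<open>y\<^sub>k(t)\<close> on \<open>\<complex>\<^sup>n\<close>, continuous in \<open>t\<close>, and boundedness of the operator means that the defects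
  \<open>q\<^sub>k(t) = sup\<^sub>v (Re y\<^sub>k(t)(v) - c \<phi>(v))\<close> have bounded sum over \<open>k\<close>. A Hahn--Banach
  argument in the finite-dimensional space \<open>\<complex>\<^sup>m\<close>, together with a partition of unity in \<open>t\<close>,
  extends \<open>y\<^sub>k\<close> to functionals on \<open>\<complex>\<^sup>m\<close> that are still continuous in \<open>t\<close> and whose defects grow
  by at most \<open>2\<^sup>-\<^sup>k\<close>. These functionals sum up to the extended operator; by \<open>\<Delta>\<^sub>2\<close> the sum converges
  uniformly in \<open>t\<close>. Quasiconvexity, \<open>\<Delta>\<^sub>2\<close> and coercivity of the functions, and the equivalence
  of the quasinorms under the embedding, all come from one description: up to constants,
  \<open>\<phi>\<^bsub>\<theta>,n\<^esub>(x)\<close> is the least \<open>s\<close> such that \<open>x\<close> is the jet at \<open>\<theta>\<close> of a holomorphic function bounded by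
  \<open>\<psi>\<^sub>0(s)\<^bsup>1 - Re z\<^esup> \<psi>\<^sub>1(s)\<^bsup>Re z\<^esup>\<close> on the strip, where
  \<open>\<psi>\<^sub>0, \<psi>\<^sub>1\<close> are the inverse functions of the endpoints.
\<close>

section \<open>Inverse Orlicz functions\<close>

text \<open>Common ground of an inverse Orlicz function and of the constant 1 that stands in for
  \<open>Ell_infty\<close> and \<open>C_zero\<close>. A value \<open>\<psi> 0 > 0\<close> is
  permitted, and continuity is asked only away from 0.\<close>

definition profile :: "(real \<Rightarrow> real) \<Rightarrow> bool" where
  "profile \<psi> \<longleftrightarrow>
     (\<forall>s\<ge>0. 0 \<le> \<psi> s) \<and> (\<forall>s>0. 0 < \<psi> s) \<and>
     (\<forall>s t. 0 \<le> s \<longrightarrow> s \<le> t \<longrightarrow> \<psi> s \<le> \<psi> t) \<and>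
     (\<forall>t a b. 0 \<le> t \<longrightarrow> t \<le> 1 \<longrightarrow> 0 \<le> a \<longrightarrow> 0 \<le> b \<longrightarrow>
        (1 - t) * \<psi> a + t * \<psi> b \<le> \<psi> ((1 - t) * a + t * b)) \<and>
     continuous_on {0<..} \<psi>"

text \<open>The last clause is the \<Delta>2 condition read through the inverse function: doubling
  the value costs a bounded factor in the argument. The constant 1 is a \<open>profile\<close> but
  not of this kind.\<close>

definition doubling_profile :: "(real \<Rightarrow> real) \<Rightarrow> bool" where
  "doubling_profile \<psi> \<longleftrightarrow>
     profile \<psi> \<and> \<psi> 0 = 0 \<and> strict_mono_on {0..} \<psi> \<and>
     (\<exists>M\<ge>1. \<forall>s\<ge>0. 2 * \<psi> s \<le> \<psi> (M * s))"

text \<open>Convexity between 0 and \<open>t\<close> gives \<phi>(s) \<le> (s/t) \<phi>(t), and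
  nondegeneracy makes the right side less than \<phi>(t).\<close>

lemma orlicz_strict_mono_on:
  assumes "orlicz \<phi>" "nondegenerate \<phi>"
  shows "strict_mono_on {0..} (\<lambda>t::real. \<phi> (of_real t))"
proof (rule strict_mono_onI)
  fix s t :: real assume st: "s \<in> {0..}" "t \<in> {0..}" "s < t"
  have "convex_on UNIV \<phi>" "\<phi> 0 = 0" using assms by (auto simp: orlicz_def)
  moreover have "0 \<le> s / t" "s / t \<le> 1" using st by auto
  ultimately have "\<phi> ((1 - s/t) *\<^sub>R 0 + (s/t) *\<^sub>R of_real t) \<le> (1 - s/t) * \<phi> 0 + s/t * \<phi> (of_real t)"
    by (intro convex_onD) auto
  moreover have "(1 - s/t) *\<^sub>R (0::complex) + (s/t) *\<^sub>R of_real t = of_real s"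
    using st by (simp add: scaleR_conv_of_real)
  ultimately have "\<phi> (of_real s) \<le> s/t * \<phi> (of_real t)" using \<open>\<phi> 0 = 0\<close> by simp
  also have "\<dots> < 1 * \<phi> (of_real t)"
    using st assms(2) by (intro mult_strict_right_mono) (auto simp: nondegenerate_def)
  finally show "\<phi> (of_real s) < \<phi> (of_real t)" by simp
qed

text \<open>A finite convex function on the plane is continuous, so the intermediate value theorem
  applies along the half-line; growth at infinity supplies arbitrarily large values.\<close>

lemma orlicz_bij_betw:
  assumes "orlicz \<phi>" "nondegenerate \<phi>"
  shows "bij_betw (\<lambda>t::real. \<phi> (of_real t)) {0..} {0..}"
proof -
  let ?f = "\<lambda>t::real. \<phi> (of_real t)"
  have "continuous_on UNIV \<phi>"
    using assms(1) by (intro convex_on_continuous) (auto simp: orlicz_def)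
  then have cont: "continuous_on A ?f" for A
    by (rule continuous_on_compose2) (auto intro!: continuous_intros)
  have "?f ` {0..} = {0..}"
  proof (intro set_eqI iffI)
    fix y assume "y \<in> ?f ` {0..}" then show "y \<in> {0..}"
      using assms(1) by (auto simp: orlicz_def)
  next
    fix y :: real assume y: "y \<in> {0..}"
    have "filterlim (\<lambda>t::real. \<phi> (of_real t * 1)) at_top at_top"
      using assms(1) unfolding orlicz_def by (metis one_neq_zero)
    then have "eventually (\<lambda>t. ?f t \<ge> y \<and> t \<ge> 0) at_top"
      by (intro eventually_conj) (auto simp: filterlim_at_top eventually_ge_at_top)
    then obtain t where t: "?f t \<ge> y" "t \<ge> 0"
      by (auto dest: eventually_happens)
    have "\<exists>x\<ge>0. x \<le> t \<and> ?f x = y"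
      using y t cont assms(1) by (intro IVT') (auto simp: orlicz_def)
    then show "y \<in> ?f ` {0..}" by auto
  qed
  then show ?thesis
    using strict_mono_on_imp_inj_on[OF orlicz_strict_mono_on[OF assms]] by (simp add: bij_betw_def)
qed

lemma orlicz_inv_properties:
  assumes "orlicz \<phi>" "nondegenerate \<phi>"
  shows orlicz_inv_nonneg: "0 \<le> u \<Longrightarrow> 0 \<le> orlicz_inv \<phi> u"
    and orlicz_orlicz_inv: "0 \<le> u \<Longrightarrow> \<phi> (of_real (orlicz_inv \<phi> u)) = u"
    and orlicz_inv_orlicz: "0 \<le> t \<Longrightarrow> orlicz_inv \<phi> (\<phi> (of_real t)) = t"
proof -
  note bij = orlicz_bij_betw[OF assms]
  show "0 \<le> u \<Longrightarrow> 0 \<le> orlicz_inv \<phi> u"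
    using bij_betw_the_inv_into[OF bij] by (auto simp: orlicz_inv_def dest!: bij_betwE)
  show "0 \<le> u \<Longrightarrow> \<phi> (of_real (orlicz_inv \<phi> u)) = u"
    using bij unfolding orlicz_inv_def by (intro f_the_inv_into_f_bij_betw) auto
  show "0 \<le> t \<Longrightarrow> orlicz_inv \<phi> (\<phi> (of_real t)) = t"
    using bij unfolding orlicz_inv_def bij_betw_def
    by (intro the_inv_into_f_f[where f = "\<lambda>t::real. \<phi> (of_real t)"]) auto
qed

text \<open>This order duality turns convexity of \<phi> into concavity of its inverse, and
  \<open>Delta2\<close> into doubling.\<close>

lemma le_orlicz_inv_iff:
  assumes "orlicz \<phi>" "nondegenerate \<phi>" "0 \<le> t" "0 \<le> u"
  shows "t \<le> orlicz_inv \<phi> u \<longleftrightarrow> \<phi> (of_real t) \<le> u"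
  using strict_mono_on_leD[OF orlicz_strict_mono_on[OF assms(1,2)]]
    strict_mono_onD[OF orlicz_strict_mono_on[OF assms(1,2)]]
    orlicz_inv_nonneg[OF assms(1,2,4)] orlicz_orlicz_inv[OF assms(1,2,4)] assms(3)
  by (smt (verit) atLeast_iff)

lemma doubling_profile_orlicz_inv:
  assumes o: "orlicz \<phi>" and n: "nondegenerate \<phi>" and "Delta2 \<phi>"
  shows "doubling_profile (orlicz_inv \<phi>)"
proof -
  let ?\<psi> = "orlicz_inv \<phi>"
  note inv = orlicz_inv_properties[OF o n]
  note le_iff = le_orlicz_inv_iff[OF o n]
  have \<phi>0: "\<phi> 0 = 0" and \<phi>nn: "\<And>x. 0 \<le> \<phi> x" using o by (auto simp: orlicz_def)
  have \<psi>0: "?\<psi> 0 = 0" using inv(3)[of 0] \<phi>0 by simp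
  have strict: "strict_mono_on {0..} ?\<psi>"
  proof (rule strict_mono_onI)
    fix s t :: real assume st: "s \<in> {0..}" "t \<in> {0..}" "s < t"
    show "?\<psi> s < ?\<psi> t"
      using le_iff[of "?\<psi> t" s] inv(1)[of t] inv(2)[of t] st by force
  qed
  have mono: "?\<psi> s \<le> ?\<psi> t" if "0 \<le> s" "s \<le> t" for s t
    using strict_mono_on_leD[OF strict] that by auto
  have pos: "0 < ?\<psi> s" if "0 < s" for s
    using strict_mono_onD[OF strict, of 0 s] that \<psi>0 by simp
  have concave: "(1 - t) * ?\<psi> a + t * ?\<psi> b \<le> ?\<psi> ((1 - t) * a + t * b)"
    if t: "0 \<le> t" "t \<le> 1" and ab: "0 \<le> a" "0 \<le> b" for t a b
  proof -
    have "\<phi> ((1 - t) *\<^sub>R of_real (?\<psi> a) + t *\<^sub>R of_real (?\<psi> b))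
        \<le> (1 - t) * \<phi> (of_real (?\<psi> a)) + t * \<phi> (of_real (?\<psi> b))"
      using o t by (intro convex_onD) (auto simp: orlicz_def)
    also have "(1 - t) *\<^sub>R complex_of_real (?\<psi> a) + t *\<^sub>R of_real (?\<psi> b)
        = of_real ((1 - t) * ?\<psi> a + t * ?\<psi> b)"
      by (simp add: scaleR_conv_of_real)
    finally show ?thesis
      using t ab inv(1)[of a] inv(1)[of b] by (subst le_iff) (auto simp: inv(2))
  qed
  \<comment> \<open>A monotone function with open image has no jumps.\<close>
  have cont: "continuous_on {0<..} ?\<psi>"
  proof (rule continuous_onI_mono)
    have "?\<psi> ` {0<..} = {0<..}"
    proof (intro set_eqI iffI)
      fix y :: real assume "y \<in> {0<..}"
      then have "y = ?\<psi> (\<phi> (of_real y))" "\<phi> (of_real y) \<in> {0<..}"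
        using inv(3)[of y] n by (auto simp: nondegenerate_def)
      then show "y \<in> ?\<psi> ` {0<..}" by blast
    qed (use pos in auto)
    then show "open (?\<psi> ` {0<..})" by simp
  qed (use mono in auto)
  have "\<exists>M\<ge>1. \<forall>s\<ge>0. 2 * ?\<psi> s \<le> ?\<psi> (M * s)"
  proof -
    obtain M where M: "M > 0" "\<And>x. \<phi> (2 * x) \<le> M * \<phi> x"
      using \<open>Delta2 \<phi>\<close> by (auto simp: Delta2_def)
    have "2 * ?\<psi> s \<le> ?\<psi> (max 1 M * s)" if "s \<ge> 0" for s
    proof (subst le_iff)
      have "\<phi> (of_real (2 * ?\<psi> s)) \<le> M * \<phi> (of_real (?\<psi> s))"
        using M(2)[of "of_real (?\<psi> s)"] by simp
      also have "\<dots> \<le> max 1 M * s" using that by (simp add: inv(2) mult_right_mono)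
      finally show "\<phi> (of_real (2 * ?\<psi> s)) \<le> max 1 M * s" .
    qed (use that inv(1)[of s] in auto)
    then show ?thesis by (intro exI[of _ "max 1 M"]) auto
  qed
  then show ?thesis
    unfolding doubling_profile_def profile_def
    using \<psi>0 strict mono pos concave cont inv(1) by blast
qed

lemma profile_const_1: "profile (\<lambda>_. 1)"
  by (auto simp: profile_def intro: continuous_intros)

lemma profile_endpoint_inv: "admissible_endpoint E \<Longrightarrow> profile (endpoint_inv E)"
  using doubling_profile_orlicz_inv profile_const_1
  by (cases E) (auto simp: doubling_profile_def)

section \<open>Geometric means of two profiles\<close>

locale interpolation_couple =
  fixes \<psi>0 \<psi>1 :: "real \<Rightarrow> real" and \<theta> :: real
  assumes \<theta>: "0 < \<theta>" "\<theta> < 1"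
    and \<psi>0: "profile \<psi>0"
    and \<psi>1: "doubling_profile \<psi>1"
begin

lemma \<psi>0_nonneg: "0 \<le> s \<Longrightarrow> 0 \<le> \<psi>0 s"
  and \<psi>0_pos: "0 < s \<Longrightarrow> 0 < \<psi>0 s"
  and \<psi>0_mono: "0 \<le> s \<Longrightarrow> s \<le> t \<Longrightarrow> \<psi>0 s \<le> \<psi>0 t"
  and \<psi>0_concave: "0 \<le> t \<Longrightarrow> t \<le> 1 \<Longrightarrow> 0 \<le> a \<Longrightarrow> 0 \<le> b \<Longrightarrow>
        (1 - t) * \<psi>0 a + t * \<psi>0 b \<le> \<psi>0 ((1 - t) * a + t * b)"
  and \<psi>0_cont: "continuous_on {0<..} \<psi>0"
  using \<psi>0 by (auto simp: profile_def)

lemma \<psi>1_nonneg: "0 \<le> s \<Longrightarrow> 0 \<le> \<psi>1 s"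
  and \<psi>1_pos: "0 < s \<Longrightarrow> 0 < \<psi>1 s"
  and \<psi>1_mono: "0 \<le> s \<Longrightarrow> s \<le> t \<Longrightarrow> \<psi>1 s \<le> \<psi>1 t"
  and \<psi>1_concave: "0 \<le> t \<Longrightarrow> t \<le> 1 \<Longrightarrow> 0 \<le> a \<Longrightarrow> 0 \<le> b \<Longrightarrow>
        (1 - t) * \<psi>1 a + t * \<psi>1 b \<le> \<psi>1 ((1 - t) * a + t * b)"
  and \<psi>1_cont: "continuous_on {0<..} \<psi>1"
  and \<psi>1_0 [simp]: "\<psi>1 0 = 0"
  and \<psi>1_strict: "0 \<le> s \<Longrightarrow> s < t \<Longrightarrow> \<psi>1 s < \<psi>1 t"
  using \<psi>1 by (auto simp: doubling_profile_def profile_def strict_mono_on_def)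

lemma \<psi>1_growth: "\<exists>B\<ge>1. \<forall>s\<ge>0. A * \<psi>1 s \<le> \<psi>1 (B * s)"
proof -
  obtain M where M: "M \<ge> 1" "\<And>s. s \<ge> 0 \<Longrightarrow> 2 * \<psi>1 s \<le> \<psi>1 (M * s)"
    using \<psi>1 by (auto simp: doubling_profile_def)
  have *: "2 ^ k * \<psi>1 s \<le> \<psi>1 (M ^ k * s)" if "s \<ge> 0" for k s
  proof (induction k)
    case (Suc k)
    have "2 ^ Suc k * \<psi>1 s \<le> 2 * \<psi>1 (M ^ k * s)" using Suc by simp
    also have "\<dots> \<le> \<psi>1 (M * (M ^ k * s))" using M that by (intro M(2)) auto
    finally show ?case by (simp add: mult.assoc)
  qed simp
  obtain k where k: "A < 2 ^ k" using real_arch_pow[of 2 A] by auto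
  have "A * \<psi>1 s \<le> \<psi>1 (M ^ k * s)" if "s \<ge> 0" for s
    using k *[OF that, of k] \<psi>1_nonneg[OF that] by (smt (verit) mult_right_mono)
  moreover have "M ^ k \<ge> 1" using M by simp
  ultimately show ?thesis by blast
qed

text \<open>Smallness near 0 comes from doubling: growth by the factor (\<psi>1 1 + 1)/e at the
  point 1/B forces \<open>\<psi>1 (1/B) < e\<close>.\<close>

lemma \<psi>1_small:
  assumes "e > 0"
  shows "\<exists>s>0. s \<le> 1 \<and> \<psi>1 s < e"
proof -
  obtain B where B: "B \<ge> 1" "\<And>s. s \<ge> 0 \<Longrightarrow> ((\<psi>1 1 + 1) / e) * \<psi>1 s \<le> \<psi>1 (B * s)"
    using \<psi>1_growth by blast
  have "((\<psi>1 1 + 1) / e) * \<psi>1 (1/B) \<le> \<psi>1 1" using B(2)[of "1/B"] B(1) by simp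
  then have "(\<psi>1 1 + 1) * \<psi>1 (1/B) \<le> \<psi>1 1 * e"
    using assms by (simp add: field_simps)
  also have "\<dots> < (\<psi>1 1 + 1) * e" using assms by simp
  finally have "\<psi>1 (1/B) < e"
    using \<psi>1_nonneg[of 1] by (simp add: mult_less_cancel_left)
  then show ?thesis using B(1) by (intro exI[of _ "1/B"]) auto
qed

text \<open>The inverse of \<phi>_\<theta> on the half-line.\<close>

definition Psi :: "real \<Rightarrow> real" where
  "Psi s = \<psi>0 s powr (1 - \<theta>) * \<psi>1 s powr \<theta>"

lemma Psi_0 [simp]: "Psi 0 = 0"
  by (simp add: Psi_def)

lemma Psi_strict: 
  assumes "0 \<le> s" "s < t"
  shows "Psi s < Psi t"
proof -
  have "Psi s \<le> \<psi>0 t powr (1 - \<theta>) * \<psi>1 s powr \<theta>" unfolding Psi_def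
    using assms \<psi>0_mono[of s t] \<psi>0_nonneg[of s] \<theta> by (intro mult_right_mono powr_mono2) auto
  also have "\<dots> < Psi t" unfolding Psi_def
    using assms \<psi>0_pos[of t] \<psi>1_strict[of s t] \<psi>1_nonneg[of s] \<theta>
    by (intro mult_strict_left_mono powr_less_mono2) auto
  finally show ?thesis .
qed

lemma Psi_mono: "0 \<le> s \<Longrightarrow> s \<le> t \<Longrightarrow> Psi s \<le> Psi t"
  using Psi_strict[of s t] by (cases "s = t") auto

lemma Psi_nonneg: "0 \<le> s \<Longrightarrow> 0 \<le> Psi s"
  using Psi_mono[of 0 s] by simp

text \<open>All growth is drawn from \<open>\<psi>1\<close>, which is asked to gain the factor
  \<open>A powr (1/\<theta>)\<close>; of \<open>\<psi>0\<close> only monotonicity is used, so that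
  it may be constant.\<close>

lemma Psi_growth:
  assumes "A \<ge> 0"
  shows "\<exists>B\<ge>1. \<forall>s\<ge>0. A * Psi s \<le> Psi (B * s)"
proof -
  obtain B where B: "B \<ge> 1" "\<And>s. s \<ge> 0 \<Longrightarrow> (A powr (1/\<theta>)) * \<psi>1 s \<le> \<psi>1 (B * s)"
    using \<psi>1_growth by blast
  have "A * Psi s \<le> Psi (B * s)" if "s \<ge> 0" for s
  proof -
    have "A * Psi s = \<psi>0 s powr (1 - \<theta>) * (A powr (1/\<theta>) * \<psi>1 s) powr \<theta>"
      using \<psi>1_nonneg[OF that] assms \<theta> by (simp add: Psi_def powr_mult powr_powr)
    also have "\<dots> \<le> Psi (B * s)" unfolding Psi_def
    proof (intro mult_mono powr_mono2)
      show "\<psi>0 s \<le> \<psi>0 (B * s)"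
        using B(1) that by (intro \<psi>0_mono) (auto simp: mult_le_cancel_right1)
    qed (use \<theta> that \<psi>0_nonneg[of s] \<psi>1_nonneg[of s] B in auto)
    finally show ?thesis .
  qed
  then show ?thesis using B(1) by blast
qed

lemma Psi_bij: "bij_betw Psi {0..} {0..}"
proof -
  have cont: "continuous_on {0<..} Psi" unfolding Psi_def
    using \<psi>0_pos \<psi>1_pos by (intro continuous_intros \<psi>0_cont \<psi>1_cont) force+
  have "\<exists>s\<ge>0. Psi s = y" if y: "y > 0" for y
  proof -
    have P1: "Psi 1 > 0" using Psi_strict[of 0 1] by simp
    \<comment> \<open>Growth from the value at 1 brackets \<open>y\<close>:
      \<open>Psi (1/B') \<le> y \<le> Psi B\<close>. The interval stays away from 0, where
      \<open>cont\<close> says nothing.\<close>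
    obtain B where B: "B \<ge> 1" "\<And>s. s \<ge> 0 \<Longrightarrow> (y / Psi 1) * Psi s \<le> Psi (B * s)"
      using Psi_growth[of "y / Psi 1"] y P1 by auto
    obtain B' where B': "B' \<ge> 1" "\<And>s. s \<ge> 0 \<Longrightarrow> (Psi 1 / y) * Psi s \<le> Psi (B' * s)"
      using Psi_growth[of "Psi 1 / y"] y P1 by auto
    have "Psi (1/B') \<le> y"
      using B'(2)[of "1/B'"] B'(1) y P1 by (simp add: field_simps)
    moreover have "y \<le> Psi B" using B(2)[of 1] P1 by simp
    moreover have "1/B' \<le> 1" using B'(1) by simp
    then have "1/B' \<le> B" using B(1) by linarith
    moreover have "continuous_on {1/B'..B} Psi"
      using B'(1) by (intro continuous_on_subset[OF cont]) (auto intro: less_le_trans[rotated])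
    ultimately obtain s where s: "1/B' \<le> s" "Psi s = y" using IVT' by metis
    have "0 \<le> 1/B'" using B'(1) by simp
    with s show ?thesis by (intro exI[of _ s]) linarith
  qed
  moreover have "\<exists>s\<ge>0. Psi s = 0" by (intro exI[of _ 0]) simp
  ultimately have "\<exists>s\<ge>0. Psi s = y" if "y \<ge> 0" for y
    using that by (cases "y = 0") simp_all
  then have "{0..} \<subseteq> Psi ` {0..}" by (fastforce simp: image_iff)
  moreover have "inj_on Psi {0..}"
    using Psi_strict by (intro strict_mono_on_imp_inj_on strict_mono_onI) auto
  ultimately show ?thesis using Psi_nonneg by (auto simp: bij_betw_def)
qed

abbreviation phi :: "complex \<Rightarrow> real" where "phi \<equiv> phi_theta \<psi>0 \<psi>1 \<theta>"

lemma phi_eq: "phi x = the_inv_into {0..} Psi (cmod x)"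
  by (simp add: phi_theta_def Psi_def[abs_def])

lemma phi_nonneg: "0 \<le> phi x"
  using bij_betw_the_inv_into[OF Psi_bij] by (auto simp: phi_eq dest!: bij_betwE)

lemma Psi_phi: "Psi (phi x) = cmod x"
  unfolding phi_eq using Psi_bij by (intro f_the_inv_into_f_bij_betw) auto

lemma phi_le_iff: "0 \<le> s \<Longrightarrow> phi x \<le> s \<longleftrightarrow> cmod x \<le> Psi s"
  using Psi_mono[of "phi x" s] Psi_strict[of s "phi x"] phi_nonneg[of x]
  by (metis Psi_phi linorder_not_less)

lemma phi_0 [simp]: "phi 0 = 0"
  using phi_le_iff[of 0 0] phi_nonneg[of 0] by simp

text \<open>The \<Delta>2 property of \<phi>_\<theta> in the form used below: a constant factor in
  the size of \<open>x\<close> becomes a constant factor in the level \<open>s\<close>.\<close>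

lemma phi_growth:
  assumes "A \<ge> 0"
  shows "\<exists>B\<ge>1. \<forall>s\<ge>0. \<forall>x. cmod x \<le> A * Psi s \<longrightarrow> phi x \<le> B * s"
proof -
  obtain B where B: "B \<ge> 1" "\<And>s. s \<ge> 0 \<Longrightarrow> A * Psi s \<le> Psi (B * s)"
    using Psi_growth[OF assms] by blast
  have "phi x \<le> B * s" if "s \<ge> 0" "cmod x \<le> A * Psi s" for s x
    using B that by (subst phi_le_iff) (auto intro: order_trans)
  then show ?thesis using B(1) by blast
qed

end

section \<open>Analytic families on the strip\<close>

lemma fps_expansion_eq:
  assumes "(\<lambda>x. f (z + x)) has_fps_expansion F"
  shows "fps_expansion f z = F"
  using assms fps_expansion_unique_complex analytic_at_imp_has_fps_expansion
    has_fps_expansion_imp_analytic by blast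

lemma taylor_coeff_fps_expansion: "taylor_coeff f j z = fps_nth (fps_expansion f z) j"
  by (simp add: taylor_coeff_def fps_expansion_def)

lemma powr_le_max_1: "0 \<le> a \<Longrightarrow> 0 \<le> p \<Longrightarrow> p \<le> 1 \<Longrightarrow> a powr p \<le> max 1 (a::real)"
  using powr_mono2[of p a "max 1 a"] powr_mono[of p 1 "max 1 a"] by simp

locale interpolation_strip = interpolation_couple +
  fixes w :: "complex \<Rightarrow> complex"
  assumes w: "conformal_strip_map \<theta> w"
begin

abbreviation D :: "complex set" where "D \<equiv> interior strip"
abbreviation jet :: "(complex \<Rightarrow> complex) \<Rightarrow> complex fps" where
  "jet f \<equiv> fps_expansion f (of_real \<theta>)"
abbreviation tc :: "(complex \<Rightarrow> complex) \<Rightarrow> nat \<Rightarrow> complex" where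
  "tc f j \<equiv> taylor_coeff f j (of_real \<theta>)"
abbreviation G :: "nat \<Rightarrow> (nat \<Rightarrow> complex) \<Rightarrow> complex \<Rightarrow> complex" where
  "G \<equiv> g_vec \<psi>0 \<psi>1 \<theta> w"
abbreviation Phi :: "nat \<Rightarrow> (nat \<Rightarrow> complex) \<Rightarrow> real" where
  "Phi \<equiv> phi_vec \<psi>0 \<psi>1 \<theta> w"

lemma D_strip: "z \<in> D \<Longrightarrow> 0 \<le> Re z \<and> Re z \<le> 1"
  using interior_subset by (auto simp: strip_def)

lemma \<theta>_in_D [simp]: "of_real \<theta> \<in> D"
proof -
  have "{z. 0 < Re z} \<inter> {z. Re z < 1} \<subseteq> D"
    by (intro interior_maximal open_Int open_halfspace_Re_gt open_halfspace_Re_lt)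
      (auto simp: strip_def)
  then show ?thesis using \<theta> by auto
qed

lemma w_holo: "w holomorphic_on D"
  and w_\<theta>: "w (of_real \<theta>) = 0"
  and w_le_1: "z \<in> D \<Longrightarrow> cmod (w z) \<le> 1"
  and deriv_w: "deriv w (of_real \<theta>) \<noteq> 0"
proof -
  show holo: "w holomorphic_on D" and "w (of_real \<theta>) = 0"
    using w by (auto simp: conformal_strip_map_def)
  show "z \<in> D \<Longrightarrow> cmod (w z) \<le> 1"
    using w interior_subset[of strip] by (force simp: conformal_strip_map_def)
  show "deriv w (of_real \<theta>) \<noteq> 0"
    using w by (intro holomorphic_injective_imp_regular[OF holo])
      (auto simp: conformal_strip_map_def bij_betw_def)
qed

text \<open>\<open>r < \<theta>\<close> keeps the real parts on the disc away from 0, and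
  \<open>r \<le> 1\<close> makes the powers of \<open>r\<close> decreasing; both enter the
  coercivity estimate.\<close>

lemma closed_disc_in_D:
  obtains r where "0 < r" "r \<le> 1" "r < \<theta>" "cball (of_real \<theta>) r \<subseteq> D"
proof -
  obtain e where e: "e > 0" "cball (complex_of_real \<theta>) e \<subseteq> D"
    using open_interior[of strip] \<theta>_in_D unfolding open_contains_cball by blast
  define r where "r = min e (min 1 (\<theta>/2))"
  have "cball (complex_of_real \<theta>) r \<subseteq> cball (of_real \<theta>) e"
    by (intro subset_cball) (simp add: r_def)
  moreover have "0 < r" "r \<le> 1" "r < \<theta>" using e(1) \<theta> by (auto simp: r_def min_def)
  ultimately show ?thesis using e(2) that by blast
qed

section \<open>Jets at \<theta> as formal power series\<close>

lemma has_jet: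
  assumes "f holomorphic_on D"
  shows "(\<lambda>x. f (of_real \<theta> + x)) has_fps_expansion jet f"
  using assms by (intro analytic_at_imp_has_fps_expansion)
    (auto simp: analytic_at intro!: exI[of _ D])

lemma jet_add: "f holomorphic_on D \<Longrightarrow> g holomorphic_on D \<Longrightarrow> jet (\<lambda>z. f z + g z) = jet f + jet g"
  and jet_diff: "f holomorphic_on D \<Longrightarrow> g holomorphic_on D \<Longrightarrow> jet (\<lambda>z. f z - g z) = jet f - jet g"
  and jet_mult: "f holomorphic_on D \<Longrightarrow> g holomorphic_on D \<Longrightarrow> jet (\<lambda>z. f z * g z) = jet f * jet g"
  and jet_cmult: "f holomorphic_on D \<Longrightarrow> jet (\<lambda>z. c * f z) = fps_const c * jet f"
  and jet_power: "f holomorphic_on D \<Longrightarrow> jet (\<lambda>z. f z ^ n) = jet f ^ n"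
  by (intro fps_expansion_eq fps_expansion_intros has_jet; assumption)+

lemma jet_ident: "jet (\<lambda>z. z - of_real \<theta>) = fps_X"
  by (rule fps_expansion_eq) (simp add: fps_expansion_intros)

lemma jet_const_0 [simp]: "jet (\<lambda>z. 0) = 0"
  by (rule fps_expansion_eq) simp

lemma jet_cong:
  assumes "\<And>z. z \<in> D \<Longrightarrow> f z = g z"
  shows "jet f = jet g"
proof (rule fps_expansion_cong)
  have "\<forall>\<^sub>F z in nhds (of_real \<theta>). z \<in> D" by (intro eventually_nhds_in_open) auto
  then show "\<forall>\<^sub>F z in nhds (of_real \<theta>). f z = g z" by eventually_elim (rule assms)
qed

section \<open>Holomorphic functions dominated by the interpolated weight\<close>

definition weight :: "real \<Rightarrow> complex \<Rightarrow> real" where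
  "weight s z = \<psi>0 s powr (1 - Re z) * \<psi>1 s powr Re z"

text \<open>The level \<open>s\<close> is the quantity of interest; constants go into
  \<open>A\<close>. Bounds are required at interior points, so no boundary values are
  involved.\<close>

definition dominated :: "real \<Rightarrow> real \<Rightarrow> (complex \<Rightarrow> complex) \<Rightarrow> bool" where
  "dominated A s f \<longleftrightarrow> f holomorphic_on D \<and> (\<forall>z\<in>D. cmod (f z) \<le> A * weight s z)"

lemma dominated_holo: "dominated A s f \<Longrightarrow> f holomorphic_on D"
  and dominated_le: "dominated A s f \<Longrightarrow> z \<in> D \<Longrightarrow> cmod (f z) \<le> A * weight s z"
  by (auto simp: dominated_def)

lemma weight_nonneg: "0 \<le> weight s z"
  by (simp add: weight_def)

lemma weight_mono: "0 \<le> s \<Longrightarrow> s \<le> t \<Longrightarrow> z \<in> D \<Longrightarrow> weight s z \<le> weight t z"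
  unfolding weight_def using D_strip[of z] \<psi>0_mono[of s t] \<psi>1_mono[of s t] \<psi>0_nonneg[of s] \<psi>1_nonneg[of s]
  by (intro mult_mono powr_mono2) auto

lemma weight_0 [simp]: "weight 0 z = 0"
  by (simp add: weight_def)

lemma weight_\<theta>: "weight s (of_real \<theta>) = Psi s"
  by (simp add: weight_def Psi_def)

lemma weight_le:
  assumes "0 \<le> s" "z \<in> D"
  shows "weight s z \<le> max 1 (\<psi>0 s) * max 1 (\<psi>1 s)"
  unfolding weight_def using assms D_strip[of z] \<psi>0_nonneg[of s] \<psi>1_nonneg[of s]
  by (intro mult_mono powr_le_max_1) auto

text \<open>A scalar \<open>r\<close> is moved into the weight by splitting it as
  \<open>r powr (1 - Re z) * r powr Re z\<close>. Each summand in the concavity inequalities is at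
  most the right side, so each summand here is at most the weight at the mean level; the factor 2
  counts the summands.\<close>

lemma weight_convex:
  assumes "0 \<le> t" "t \<le> 1" "0 \<le> a" "0 \<le> b" "z \<in> D"
  shows "(1 - t) * weight a z + t * weight b z \<le> 2 * weight ((1 - t) * a + t * b) z"
proof -
  define c where "c = (1 - t) * a + t * b"
  have nn: "0 \<le> \<psi>0 a" "0 \<le> \<psi>0 b" "0 \<le> \<psi>1 a" "0 \<le> \<psi>1 b"
    using assms \<psi>0_nonneg \<psi>1_nonneg by auto
  have *: "r * weight e z \<le> weight c z"
    if "0 \<le> r" "0 \<le> \<psi>0 e" "0 \<le> \<psi>1 e" "r * \<psi>0 e \<le> \<psi>0 c" "r * \<psi>1 e \<le> \<psi>1 c" for r e
  proof (cases "r = 0")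
    case False
    have "r * weight e z = (r * \<psi>0 e) powr (1 - Re z) * (r * \<psi>1 e) powr Re z"
      using that False powr_add[of r "1 - Re z" "Re z"]
      by (simp add: weight_def powr_mult)
    also have "\<dots> \<le> weight c z" unfolding weight_def
      using that D_strip[OF assms(5)] by (intro mult_mono powr_mono2) auto
    finally show ?thesis .
  qed (simp add: weight_nonneg)
  have p: "(1 - t) * \<psi>0 a + t * \<psi>0 b \<le> \<psi>0 c" "(1 - t) * \<psi>1 a + t * \<psi>1 b \<le> \<psi>1 c"
    unfolding c_def using assms by (auto intro: \<psi>0_concave \<psi>1_concave)
  have q: "0 \<le> (1 - t) * \<psi>0 a" "0 \<le> t * \<psi>0 b" "0 \<le> (1 - t) * \<psi>1 a" "0 \<le> t * \<psi>1 b"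
    using nn assms by auto
  have "(1 - t) * weight a z \<le> weight c z" "t * weight b z \<le> weight c z"
    using assms nn p q by (intro *; linarith)+
  then show ?thesis by (simp add: c_def)
qed

lemma dominated_mono:
  assumes "dominated A s f" "A \<le> A'" "0 \<le> A'" "0 \<le> s" "s \<le> t"
  shows "dominated A' t f"
  unfolding dominated_def
proof safe
  fix z assume z: "z \<in> D"
  have "cmod (f z) \<le> A * weight s z" using assms z by (auto simp: dominated_def)
  also have "\<dots> \<le> A' * weight t z"
    using assms z weight_mono[of s t z] weight_nonneg[of s z] by (intro mult_mono) auto
  finally show "cmod (f z) \<le> A' * weight t z" .
qed (use assms in \<open>auto simp: dominated_def\<close>)

lemma dominated_add:
  assumes f: "dominated A s f" and g: "dominated B s g"
  shows "dominated (A + B) s (\<lambda>z. f z + g z)"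
  unfolding dominated_def
proof safe
  fix z assume z: "z \<in> D"
  show "cmod (f z + g z) \<le> (A + B) * weight s z"
    unfolding distrib_right using dominated_le[OF f z] dominated_le[OF g z] by (rule norm_triangle_mono)
qed (intro holomorphic_intros dominated_holo[OF f] dominated_holo[OF g])

lemma dominated_mult:
  assumes f: "dominated A s f" and v: "v holomorphic_on D" "\<And>z. z \<in> D \<Longrightarrow> cmod (v z) \<le> V" "0 \<le> V"
  shows "dominated (V * A) s (\<lambda>z. v z * f z)"
  unfolding dominated_def
proof safe
  fix z assume z: "z \<in> D"
  have "cmod (v z * f z) \<le> V * (A * weight s z)"
    unfolding norm_mult using v z dominated_le[OF f z] by (intro mult_mono) auto
  then show "cmod (v z * f z) \<le> V * A * weight s z" by (simp add: mult.assoc)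
qed (intro holomorphic_intros v dominated_holo[OF f])

lemma dominated_cmult:
  assumes "dominated A s f"
  shows "dominated (cmod c * A) s (\<lambda>z. c * f z)"
  using assms by (intro dominated_mult) (auto intro: holomorphic_intros)

lemma dominated_diff:
  assumes "dominated A s f" "dominated B s g"
  shows "dominated (A + B) s (\<lambda>z. f z - g z)"
  using dominated_add[OF assms(1) dominated_cmult[OF assms(2), of "- 1"]] by simp

lemma dominated_convex:
  assumes "dominated A a f" "dominated A b g" "0 \<le> a" "0 \<le> b" "0 \<le> t" "t \<le> 1" "0 \<le> A"
  shows "dominated (2 * A) ((1 - t) * a + t * b) (\<lambda>z. of_real (1 - t) * f z + of_real t * g z)"
  unfolding dominated_def
proof safe
  fix z assume z: "z \<in> D"
  have "cmod (of_real (1 - t) * f z + of_real t * g z) \<le> (1 - t) * cmod (f z) + t * cmod (g z)"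
    using assms by (intro norm_triangle_mono) (auto simp: norm_mult simp del: of_real_diff)
  also have "\<dots> \<le> (1 - t) * (A * weight a z) + t * (A * weight b z)"
    using assms z by (intro add_mono mult_left_mono) (auto simp: dominated_def)
  also have "\<dots> = A * ((1 - t) * weight a z + t * weight b z)" by (simp add: algebra_simps)
  also have "\<dots> \<le> A * (2 * weight ((1 - t) * a + t * b) z)"
    using assms z by (intro mult_left_mono weight_convex) auto
  finally show "cmod (of_real (1 - t) * f z + of_real t * g z) \<le> 2 * A * weight ((1 - t) * a + t * b) z"
    by simp
qed (use assms in \<open>auto simp: dominated_def intro!: holomorphic_intros\<close>)

text \<open>For \<open>s > 0\<close> this is a zero-free holomorphic function with modulus
  \<open>weight s\<close>; dividing by it turns a weighted bound into a uniform one.\<close>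

definition envelope :: "real \<Rightarrow> complex \<Rightarrow> complex" where
  "envelope s z = complex_of_real (\<psi>0 s) powr (1 - z) * complex_of_real (\<psi>1 s) powr z"

lemma envelope_holo: "envelope s holomorphic_on A"
  unfolding envelope_def[abs_def] by (intro holomorphic_intros)

lemma norm_envelope: "0 \<le> s \<Longrightarrow> cmod (envelope s z) = weight s z"
  using \<psi>0_nonneg[of s] \<psi>1_nonneg[of s]
  by (simp add: envelope_def weight_def norm_mult norm_powr_real_powr)

lemma g_scalar_eq: "g_scalar \<psi>0 \<psi>1 \<theta> x z = envelope (phi x) z * sgn x"
  by (simp add: g_scalar_def envelope_def)

lemma dominated_g_scalar: "dominated 1 (phi x) (g_scalar \<psi>0 \<psi>1 \<theta> x)"
  unfolding dominated_def
proof safe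
  show "g_scalar \<psi>0 \<psi>1 \<theta> x holomorphic_on D"
    unfolding g_scalar_eq[abs_def] by (intro holomorphic_intros envelope_holo)
  show "cmod (g_scalar \<psi>0 \<psi>1 \<theta> x z) \<le> 1 * weight (phi x) z" for z
    by (simp add: g_scalar_eq norm_mult norm_envelope phi_nonneg norm_sgn weight_nonneg)
qed

lemma g_scalar_\<theta>: "g_scalar \<psi>0 \<psi>1 \<theta> x (of_real \<theta>) = x"
proof -
  have "envelope (phi x) (of_real \<theta>) = of_real (Psi (phi x))"
    using \<psi>0_nonneg[OF phi_nonneg[of x]] \<psi>1_nonneg[OF phi_nonneg[of x]]
      powr_of_real[of _ "1 - \<theta>"]
    by (simp add: envelope_def Psi_def powr_of_real)
  then show ?thesis
    by (cases "x = 0") (auto simp: g_scalar_eq Psi_phi sgn_div_norm scaleR_conv_of_real)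
qed

lemma tc_0: "tc f 0 = f (of_real \<theta>)"
  by (simp add: taylor_coeff_def)

text \<open>A Schwarz lemma with weight. The quotient of \<open>f\<close> by
  \<open>envelope s\<close> and by z - \<theta> is bounded by \<open>A / r\<close> where |z -
  \<theta>| \<ge> r, and the maximum principle carries this bound into the disc. The level is
  unchanged; only the constant grows.\<close>

lemma dominated_divide_1:
  assumes r: "0 < r" "cball (of_real \<theta>) r \<subseteq> D" and f: "dominated A s f" "f (of_real \<theta>) = 0" and s: "0 \<le> s"
    and A: "0 \<le> A"
  shows "\<exists>k. dominated (A / r) s k \<and> jet f = fps_X * jet k"
\<comment> \<open>At level 0 the envelope cannot be divided by, but the weight vanishes and
  \<open>f\<close> is zero on \<open>D\<close>.\<close>
proof (cases "s = 0")
  case True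
  then have "jet f = jet (\<lambda>z. 0)" using f by (intro jet_cong) (auto simp: dominated_def)
  then show ?thesis using True by (intro exI[of _ "\<lambda>z. 0"]) (auto simp: dominated_def)
next
  case False
  then have s: "s > 0" using s by simp
  define k where "k = (\<lambda>z. if z = of_real \<theta> then deriv f (of_real \<theta>) else (f z - f (of_real \<theta>)) / (z - of_real \<theta>))"
  have k: "k holomorphic_on D" unfolding k_def
    using f by (intro pole_lemma_open) (auto simp: dominated_def)
  have fk: "f z = (z - of_real \<theta>) * k z" for z using f by (simp add: k_def)
  have env: "envelope s z \<noteq> 0" for z
    using \<psi>0_pos[OF s] \<psi>1_pos[OF s] by (auto simp: envelope_def)
  have q: "(\<lambda>z. k z / envelope s z) holomorphic_on D"
    by (intro holomorphic_intros k envelope_holo env)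
  have far: "cmod (k z / envelope s z) \<le> A / r" if "z \<in> D" "r \<le> cmod (z - of_real \<theta>)" for z
  proof -
    have wpos: "weight s z > 0" using norm_envelope[of s z] env[of z] s by (metis zero_less_norm_iff less_imp_le)
    have "r * cmod (k z) \<le> cmod (f z)" using that by (simp add: fk norm_mult mult_right_mono)
    also have "\<dots> \<le> A * weight s z" using f that by (auto simp: dominated_def)
    finally show ?thesis using r wpos s by (simp add: norm_divide norm_envelope field_simps)
  qed
  have bound: "cmod (k z / envelope s z) \<le> A / r" if z: "z \<in> D" for z
  proof (cases "r \<le> cmod (z - of_real \<theta>)")
    case False
    show ?thesis
    proof (rule maximum_modulus_frontier[where S = "cball (of_real \<theta>) r" and f = "\<lambda>z. k z / envelope s z"])
      show "(\<lambda>z. k z / envelope s z) holomorphic_on interior (cball (of_real \<theta>) r)"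
        using q r(2) interior_subset[of "cball (complex_of_real \<theta>) r"] by (blast intro: holomorphic_on_subset)
      show "continuous_on (closure (cball (of_real \<theta>) r)) (\<lambda>z. k z / envelope s z)"
        using q r(2) by (auto intro!: holomorphic_on_imp_continuous_on intro: holomorphic_on_subset)
      show "cmod (k z / envelope s z) \<le> A / r" if "z \<in> frontier (cball (of_real \<theta>) r)" for z
        using that r by (intro far) (auto simp: dist_norm norm_minus_commute sphere_def)
    qed (use False in \<open>auto simp: dist_norm norm_minus_commute\<close>)
  qed (use far z in auto)
  have "cmod (k z) \<le> A / r * weight s z" if "z \<in> D" for z
  proof -
    have "cmod (k z) = cmod (k z / envelope s z) * weight s z"
      using env[of z] s by (simp add: norm_divide flip: norm_envelope)
    also have "\<dots> \<le> A / r * weight s z" using bound[OF that] weight_nonneg by (rule mult_right_mono)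
    finally show ?thesis .
  qed
  moreover have "jet f = fps_X * jet k"
    using jet_mult[OF _ k, of "\<lambda>z. z - of_real \<theta>"]
    by (simp add: jet_ident holomorphic_intros flip: fk)
  ultimately show ?thesis using k by (intro exI[of _ k]) (auto simp: dominated_def)
qed

text \<open>Removing a zero of order \<open>l\<close> at \<theta> shifts the jet down by
  \<open>l\<close> places; each division costs a factor \<open>1 / r\<close>.\<close>

lemma dominated_divide:
  assumes r: "0 < r" "cball (of_real \<theta>) r \<subseteq> D"
  shows "dominated A s f \<Longrightarrow> 0 \<le> s \<Longrightarrow> 0 \<le> A \<Longrightarrow> (\<And>j. j < l \<Longrightarrow> tc f j = 0) \<Longrightarrow>
    \<exists>k. dominated (A / r ^ l) s k \<and> (\<forall>j. tc k j = tc f (j + l))"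
proof (induction l arbitrary: A f)
  case 0
  then show ?case by (intro exI[of _ f]) auto
next
  case (Suc l)
  obtain k where k: "dominated (A / r) s k" "jet f = fps_X * jet k"
    using dominated_divide_1[OF r Suc.prems(1)] Suc.prems(2,3) Suc.prems(4)[of 0] by (auto simp: tc_0)
  have tck: "tc k j = tc f (Suc j)" for j
    using k(2) by (simp add: taylor_coeff_fps_expansion)
  have "\<exists>h. dominated (A / r / r ^ l) s h \<and> (\<forall>j. tc h j = tc k (j + l))"
    by (rule Suc.IH) (use k Suc.prems r tck in auto)
  then show ?case using tck by (simp add: field_simps)
qed

section \<open>Description of \<open>Phi\<close> by jets of dominated functions\<close>

definition resid :: "nat \<Rightarrow> (nat \<Rightarrow> complex) \<Rightarrow> complex" where
  "resid n x = x n - tc (G n x) n"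

text \<open>With \<open>G 0 x = 0\<close> a single recursion covers the base case as well: for
  \<open>n = 0\<close> the power of \<open>w\<close> and the constant are 1, and
  \<open>resid 0 x\<close> is \<open>x 0\<close>.\<close>

lemma G_Suc: "G (Suc n) x = (\<lambda>z. G n x z + 1 / (fact (Suc n) * deriv w (of_real \<theta>) ^ n) *
   (w z ^ n * g_scalar \<psi>0 \<psi>1 \<theta> (fact (Suc n) * resid n x) z))"
  by (cases n) (auto simp: resid_def taylor_coeff_def)

lemma Phi_Suc: "Phi (Suc n) x = Phi n x + phi (resid n x)"
  by (cases n) (auto simp: resid_def taylor_coeff_def)

lemma Phi_nonneg: "0 \<le> Phi n x"
  by (induction n) (auto simp: Phi_Suc phi_nonneg simp del: phi_vec.simps(2,3))

lemma g_scalar_holo: "g_scalar \<psi>0 \<psi>1 \<theta> x holomorphic_on D"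
  using dominated_g_scalar by (rule dominated_holo)

lemma G_holo: "G n x holomorphic_on D"
  by (induction n) (auto simp: G_Suc simp del: g_vec.simps(2,3) intro!: holomorphic_intros w_holo g_scalar_holo)

text \<open>The jet of \<open>w\<close> is \<open>fps_X * W\<close>, where \<open>W\<close> has
  constant term w'(\<theta>). Hence the summand added at stage \<open>n\<close> starts at order
  \<open>n\<close>, leaves the earlier coefficients alone and, by the choice of the normalising
  constant, has leading coefficient \<open>resid n x\<close>.\<close>

lemma tc_G: "j < n \<Longrightarrow> tc (G n x) j = x j"
proof (induction n)
  case (Suc n)
  define c where "c = 1 / (fact (Suc n) * deriv w (complex_of_real \<theta>) ^ n)"
  define u where "u = fact (Suc n) * resid n x"
  define W where "W = fps_shift 1 (jet w)"
  have "fps_nth (jet w) 0 = 0"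
    using w_\<theta> by (simp flip: taylor_coeff_fps_expansion add: tc_0)
  then have W: "jet w = fps_X * W" unfolding W_def
    by (intro fps_ext) (auto simp: fps_X_mult_nth)
  have W0: "fps_nth W 0 = deriv w (of_real \<theta>)"
    by (simp add: W_def flip: taylor_coeff_fps_expansion) (simp add: taylor_coeff_def)
  let ?S = "W ^ n * jet (g_scalar \<psi>0 \<psi>1 \<theta> u)"
  have "jet (G (Suc n) x) = jet (G n x) + fps_const c * (jet w ^ n * jet (g_scalar \<psi>0 \<psi>1 \<theta> u))"
    unfolding G_Suc c_def[symmetric] u_def[symmetric]
    by (subst jet_add jet_cmult jet_mult jet_power,
        (intro G_holo holomorphic_intros w_holo g_scalar_holo)+)+ simp
  also have "\<dots> = jet (G n x) + fps_const c * (fps_X ^ n * ?S)"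
    by (simp add: W power_mult_distrib mult.assoc)
  finally have "tc (G (Suc n) x) j = tc (G n x) j + c * (if j < n then 0 else fps_nth ?S (j - n))"
    by (simp add: taylor_coeff_fps_expansion fps_X_power_mult_nth)
  moreover have "fps_nth ?S 0 = deriv w (of_real \<theta>) ^ n * u"
    by (simp add: W0 fps_nth_power_0 g_scalar_\<theta> tc_0 flip: taylor_coeff_fps_expansion)
  ultimately show ?case
    using Suc deriv_w by (cases "j = n") (auto simp: c_def u_def resid_def simp del: of_nat_Suc fact_Suc)
qed simp

text \<open>One half of the jet description: \<open>x\<close> is the jet of a function dominated at
  a level comparable to \<open>Phi n x\<close>. As |w| \<le> 1 on \<open>D\<close>, each new summand
  is bounded, up to a constant, by the weight at level
  \<open>phi (fact (Suc n) * resid n x)\<close>, and \<open>phi_growth\<close> absorbs the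
  factorial.\<close>

lemma dominated_G:
  "\<exists>A\<ge>0. \<exists>M\<ge>1. \<forall>x. dominated A (M * Phi n x) (G n x)"
proof (induction n)
  case 0
  then show ?case by (intro exI[of _ 0] conjI exI[of _ 1]) (auto simp: dominated_def)
next
  case (Suc n)
  then obtain A M where A: "A \<ge> 0" and M: "M \<ge> 1" and dom: "\<And>x. dominated A (M * Phi n x) (G n x)"
    by blast
  define c where "c = 1 / (fact (Suc n) * deriv w (complex_of_real \<theta>) ^ n)"
  obtain B where B: "B \<ge> 1" "\<And>s x. s \<ge> 0 \<Longrightarrow> cmod x \<le> fact (Suc n) * Psi s \<Longrightarrow> phi x \<le> B * s"
    using phi_growth[of "fact (Suc n)"] by auto
  have "dominated (A + cmod c) (max M B * Phi (Suc n) x) (G (Suc n) x)" for x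
  proof -
    define u where "u = fact (Suc n) * resid n x"
    have "cmod u = cmod (fact (Suc n)) * cmod (resid n x)"
      by (simp only: u_def norm_mult)
    then have "cmod u \<le> fact (Suc n) * Psi (phi (resid n x))"
      by (simp only: Psi_phi norm_fact)
    then have "phi u \<le> B * phi (resid n x)" by (intro B(2) phi_nonneg)
    also have "\<dots> \<le> max M B * Phi (Suc n) x"
      using Phi_nonneg[of n x] phi_nonneg[of "resid n x"] B(1) unfolding Phi_Suc by (intro mult_mono) auto
    finally have u: "phi u \<le> max M B * Phi (Suc n) x" .
    have "dominated (1 * 1) (phi u) (\<lambda>z. w z ^ n * g_scalar \<psi>0 \<psi>1 \<theta> u z)"
      by (intro dominated_mult dominated_g_scalar holomorphic_intros w_holo)
        (auto simp: norm_power w_le_1 power_le_one)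
    then have "dominated (cmod c * (1 * 1)) (phi u) (\<lambda>z. c * (w z ^ n * g_scalar \<psi>0 \<psi>1 \<theta> u z))"
      by (rule dominated_cmult)
    then have 1: "dominated (cmod c) (max M B * Phi (Suc n) x) (\<lambda>z. c * (w z ^ n * g_scalar \<psi>0 \<psi>1 \<theta> u z))"
      by (rule dominated_mono) (use u phi_nonneg in auto)
    have 2: "dominated A (max M B * Phi (Suc n) x) (G n x)"
    proof (rule dominated_mono[OF dom])
      show "M * Phi n x \<le> max M B * Phi (Suc n) x"
        using Phi_nonneg[of n x] phi_nonneg[of "resid n x"] M unfolding Phi_Suc by (intro mult_mono) auto
    qed (use A M Phi_nonneg[of n x] in auto)
    show ?thesis
      using dominated_add[OF 2 1] unfolding G_Suc c_def u_def .
  qed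
  then show ?case using A M
    by (intro exI[of _ "A + cmod c"] conjI exI[of _ "max M B"]) auto
qed

text \<open>The converse half. By induction \<open>G n x\<close> lives at a level comparable to
  \<open>s\<close>. The difference \<open>f - G n x\<close> vanishes to order \<open>n\<close> at
  \<theta>, and after division by the n-th power of z - \<theta> its value at \<theta> is
  \<open>resid n x\<close>; the bound by \<open>Psi\<close> at that point controls
  \<open>phi (resid n x)\<close>.\<close>

lemma Phi_le:
  "0 \<le> A \<Longrightarrow> \<exists>B\<ge>1. \<forall>s\<ge>0. \<forall>f x. dominated A s f \<longrightarrow> (\<forall>j<n. tc f j = x j) \<longrightarrow> Phi n x \<le> B * s"
proof (induction n)
  case 0
  then show ?case by (intro exI[of _ 1]) auto
next
  case (Suc n)
  then obtain B where B: "B \<ge> 1"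
      "\<And>s f x. 0 \<le> s \<Longrightarrow> dominated A s f \<Longrightarrow> (\<forall>j<n. tc f j = x j) \<Longrightarrow> Phi n x \<le> B * s"
    by blast
  obtain A2 M where A2: "A2 \<ge> 0" and M: "M \<ge> 1" and dom: "\<And>x. dominated A2 (M * Phi n x) (G n x)"
    using dominated_G[of n] by blast
  obtain r where r: "0 < r" "cball (of_real \<theta>) r \<subseteq> D" using closed_disc_in_D by blast
  define A3 where "A3 = (A + A2) / r ^ n"
  have A3: "A3 \<ge> 0" using A2 Suc.prems r by (simp add: A3_def)
  obtain B3 where B3: "B3 \<ge> 1" "\<And>s x. s \<ge> 0 \<Longrightarrow> cmod x \<le> A3 * Psi s \<Longrightarrow> phi x \<le> B3 * s"
    using phi_growth[OF A3] by blast
  have "Phi (Suc n) x \<le> (B + B3 * (M * B)) * s"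
    if s: "0 \<le> s" and f: "dominated A s f" and x: "\<forall>j<Suc n. tc f j = x j" for s f x
  proof -
    \<comment> \<open>A level high enough for both \<open>f\<close> and
      \<open>G n x\<close>.\<close>
    define t where "t = M * B * s"
    have Phi: "Phi n x \<le> B * s" using B(2)[OF s f] x by auto
    have "1 * 1 \<le> M * B" using B(1) M by (intro mult_mono) auto
    then have st: "s \<le> t" using s by (simp add: t_def mult_le_cancel_right1)
    have "dominated A t f" by (rule dominated_mono[OF f]) (use s st Suc.prems in auto)
    moreover have "dominated A2 t (G n x)"
    proof (rule dominated_mono[OF dom])
      show "M * Phi n x \<le> t" using mult_left_mono[OF Phi, of M] M by (simp add: t_def mult.assoc)
    qed (use A2 M Phi_nonneg[of n x] in auto)
    ultimately have d: "dominated (A + A2) t (\<lambda>z. f z - G n x z)" by (rule dominated_diff)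
    have tcd: "tc (\<lambda>z. f z - G n x z) j = tc f j - tc (G n x) j" for j
      using dominated_holo[OF f] by (simp add: taylor_coeff_fps_expansion jet_diff G_holo)
    have "\<exists>k. dominated ((A + A2) / r ^ n) t k \<and> (\<forall>j. tc k j = tc (\<lambda>z. f z - G n x z) (j + n))"
      using x s st A2 Suc.prems by (intro dominated_divide r d) (auto simp: tcd tc_G)
    then obtain k where k: "dominated A3 t k" "\<And>j. tc k j = tc (\<lambda>z. f z - G n x z) (j + n)"
      unfolding A3_def by blast
    have "k (of_real \<theta>) = resid n x"
      using k(2)[of 0] x by (simp add: tcd tc_0 resid_def)
    then have "cmod (resid n x) \<le> A3 * Psi t"
      using dominated_le[OF k(1) \<theta>_in_D] by (simp add: weight_\<theta>)
    then have "phi (resid n x) \<le> B3 * t" using s st by (intro B3) auto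
    then show ?thesis using Phi by (simp add: Phi_Suc t_def algebra_simps del: phi_vec.simps)
  qed
  moreover have "B + B3 * (M * B) \<ge> 1 + 0"
    using B B3(1) M by (intro add_mono mult_nonneg_nonneg) auto
  ultimately show ?case by (intro exI[of _ "B + B3 * (M * B)"]) auto
qed

section \<open>Quasi-Young properties of \<open>Phi\<close>, read off from the jet
  description\<close>

lemma Phi_0: "Phi n (\<lambda>_. 0) = 0"
proof -
  obtain B where "\<And>s f x. 0 \<le> s \<Longrightarrow> dominated 0 s f \<Longrightarrow> (\<forall>j<n. tc f j = x j) \<Longrightarrow> Phi n x \<le> B * s"
    using Phi_le[of 0 n] by blast
  from this[of 0 "\<lambda>_. 0" "\<lambda>_. 0"] show ?thesis
    using Phi_nonneg[of n "\<lambda>_. 0"] by (simp add: dominated_def taylor_coeff_fps_expansion)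
qed

text \<open>Jets are linear in the function, so the same combination of \<open>G n x\<close> and
  \<open>G n y\<close> has the required jet. It is dominated at the mean level by
  \<open>dominated_convex\<close>, and \<open>Phi_le\<close> converts this back.\<close>

lemma Phi_quasiconvex:
  "\<exists>C\<ge>1. \<forall>x y t. 0 \<le> t \<longrightarrow> t \<le> 1 \<longrightarrow>
     Phi n (\<lambda>j. of_real (1 - t) * x j + of_real t * y j) \<le> C * ((1 - t) * Phi n x + t * Phi n y)"
proof -
  obtain A M where A: "A \<ge> 0" and M: "M \<ge> 1" and dom: "\<And>x. dominated A (M * Phi n x) (G n x)"
    using dominated_G[of n] by blast
  obtain B where B: "B \<ge> 1"
      "\<And>s f x. 0 \<le> s \<Longrightarrow> dominated (2 * A) s f \<Longrightarrow> (\<forall>j<n. tc f j = x j) \<Longrightarrow> Phi n x \<le> B * s"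
    using Phi_le[of "2 * A" n] A by auto
  have "Phi n (\<lambda>j. of_real (1 - t) * x j + of_real t * y j) \<le> B * M * ((1 - t) * Phi n x + t * Phi n y)"
    if "0 \<le> t" "t \<le> 1" for x y t
  proof -
    have "dominated (2 * A) ((1 - t) * (M * Phi n x) + t * (M * Phi n y))
        (\<lambda>z. of_real (1 - t) * G n x z + of_real t * G n y z)"
      using that A M Phi_nonneg by (intro dominated_convex dom) auto
    then have "Phi n (\<lambda>j. of_real (1 - t) * x j + of_real t * y j)
        \<le> B * ((1 - t) * (M * Phi n x) + t * (M * Phi n y))"
    proof (rule B(2)[rotated])
      show "\<forall>j<n. tc (\<lambda>z. of_real (1 - t) * G n x z + of_real t * G n y z) j
          = of_real (1 - t) * x j + of_real t * y j"
        by (simp add: taylor_coeff_fps_expansion jet_add jet_cmult G_holo holomorphic_intros)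
          (simp add: tc_G flip: taylor_coeff_fps_expansion)
    qed (use that M Phi_nonneg[of n x] Phi_nonneg[of n y] in auto)
    then show ?thesis by (simp add: algebra_simps)
  qed
  moreover have "1 * 1 \<le> B * M" using B(1) M by (intro mult_mono) auto
  ultimately show ?thesis by (intro exI[of _ "B * M"]) auto
qed

text \<open>A bounded multiple of \<open>G n x\<close> changes the constant of domination but not
  the level. This contains \<Delta>2 and, up to a constant, invariance under rotation.\<close>

lemma Phi_scale:
  "\<exists>M\<ge>0. \<forall>c x. cmod c \<le> R \<longrightarrow> Phi n (\<lambda>j. c * x j) \<le> M * Phi n x"
proof -
  obtain A M where A: "A \<ge> 0" and M: "M \<ge> 1" and dom: "\<And>x. dominated A (M * Phi n x) (G n x)"
    using dominated_G[of n] by blast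
  obtain B where B: "B \<ge> 1"
      "\<And>s f x. 0 \<le> s \<Longrightarrow> dominated (\<bar>R\<bar> * A) s f \<Longrightarrow> (\<forall>j<n. tc f j = x j) \<Longrightarrow> Phi n x \<le> B * s"
    using Phi_le[of "\<bar>R\<bar> * A" n] A by auto
  have "Phi n (\<lambda>j. c * x j) \<le> (B * M) * Phi n x" if "cmod c \<le> R" for c x
  proof -
    have "dominated (\<bar>R\<bar> * A) (M * Phi n x) (\<lambda>z. c * G n x z)"
      by (rule dominated_mono[OF dominated_cmult[OF dom]])
        (use that A M Phi_nonneg[of n x] in \<open>auto intro!: mult_right_mono\<close>)
    moreover have "\<forall>j<n. tc (\<lambda>z. c * G n x z) j = c * x j"
      by (simp add: taylor_coeff_fps_expansion jet_cmult G_holo)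
        (simp add: tc_G flip: taylor_coeff_fps_expansion)
    ultimately have "Phi n (\<lambda>j. c * x j) \<le> B * (M * Phi n x)"
      using M Phi_nonneg[of n x] by (intro B(2)) auto
    then show ?thesis by simp
  qed
  then show ?thesis using B(1) M by (intro exI[of _ "B * M"]) auto
qed

text \<open>If \<open>Phi n x\<close> were small, \<open>G n x\<close> would be dominated at a small
  level \<open>s\<close>. Then \<open>\<psi>1 s\<close> is small, and so is the weight on a disc
  about \<theta>, where real parts are at least \<open>\<theta> - r > 0\<close>. Cauchy's estimate
  would force all coefficients below 1.\<close>

lemma Phi_coercive:
  "\<exists>c>0. \<forall>x. (\<exists>j<n. 1 \<le> cmod (x j)) \<longrightarrow> c \<le> Phi n x"
proof -
  obtain A M where A: "A \<ge> 0" and M: "M \<ge> 1" and dom: "\<And>x. dominated A (M * Phi n x) (G n x)"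
    using dominated_G[of n] by blast
  obtain r where r: "0 < r" "r \<le> 1" "r < \<theta>" "cball (of_real \<theta>) r \<subseteq> D" using closed_disc_in_D by blast
  define K where "K = max 1 (\<psi>0 1)"
  \<comment> \<open>Chosen so that the Cauchy bound \<open>A * K * d / r ^ j\<close> is below 1 for
    every \<open>j < n\<close>; \<open>K\<close> bounds the contribution of \<open>\<psi>0\<close>
    at levels up to 1.\<close>
  define d where "d = r ^ n / (A * K + 1)"
  have K: "K \<ge> 1" by (simp add: K_def)
  have AK: "0 \<le> A * K" using A K by simp
  then have d: "0 < d" "A * K * d < r ^ n"
    using r by (auto simp: d_def field_simps)
  \<comment> \<open>The root yields \<open>\<psi>1 s powr (\<theta> - r) \<le> d\<close>; the
    minimum with 1 makes powers of \<open>\<psi>1 s\<close> decrease in the exponent.\<close>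
  define e where "e = min 1 (d powr (1 / (\<theta> - r)))"
  have "e > 0" using d by (simp add: e_def)
  then obtain s where s: "s > 0" "s \<le> 1" "\<psi>1 s < e" using \<psi>1_small by blast
  have "\<psi>1 s powr (\<theta> - r) \<le> (d powr (1 / (\<theta> - r))) powr (\<theta> - r)"
    using s r \<psi>1_nonneg[of s] by (intro powr_mono2) (auto simp: e_def)
  also have "\<dots> = d" using r d by (simp add: powr_powr)
  finally have small: "\<psi>1 s powr (\<theta> - r) \<le> d" .
  have weight: "weight s z \<le> K * d" if z: "z \<in> cball (of_real \<theta>) r" for z
  proof -
    have "z \<in> D" using z r by auto
    have "\<bar>Re (of_real \<theta> - z)\<bar> \<le> cmod (of_real \<theta> - z)" by (rule abs_Re_le_cmod)
    also have "\<dots> \<le> r" using z by (simp add: dist_norm)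
    finally have "\<theta> - r \<le> Re z" by simp
    then have "\<psi>1 s powr Re z \<le> \<psi>1 s powr (\<theta> - r)"
      using s \<psi>1_pos[of s] by (intro powr_mono') (auto simp: e_def)
    moreover have "\<psi>0 s powr (1 - Re z) \<le> max 1 (\<psi>0 s)"
      using D_strip[OF \<open>z \<in> D\<close>] s \<psi>0_nonneg by (intro powr_le_max_1) auto
    moreover have "\<dots> \<le> K" using \<psi>0_mono[of s 1] s by (auto simp: K_def)
    ultimately show ?thesis using small K unfolding weight_def by (intro mult_mono) auto
  qed
  have "s / M \<le> Phi n x" if j: "j < n" "1 \<le> cmod (x j)" for x j
  proof (rule ccontr)
    assume "\<not> s / M \<le> Phi n x"
    then have "M * Phi n x \<le> s" using M by (simp add: field_simps)
    then have G: "dominated A s (G n x)"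
      using dominated_mono[OF dom] A M Phi_nonneg[of n x] by simp
    have "cmod ((deriv ^^ j) (G n x) (of_real \<theta>)) \<le> fact j * (A * (K * d)) / r ^ j"
    proof (rule Cauchy_inequality)
      show "G n x holomorphic_on ball (of_real \<theta>) r"
        using G_holo r(4) ball_subset_cball by (blast intro: holomorphic_on_subset)
      show "continuous_on (cball (of_real \<theta>) r) (G n x)"
        using G_holo r(4) by (blast intro: holomorphic_on_subset holomorphic_on_imp_continuous_on)
      show "cmod (G n x z) \<le> A * (K * d)" if "cmod (of_real \<theta> - z) = r" for z
      proof -
        have z: "z \<in> cball (of_real \<theta>) r" using that by (simp add: dist_norm)
        have "cmod (G n x z) \<le> A * weight s z" using G z r(4) by (auto simp: dominated_def)
        also have "\<dots> \<le> A * (K * d)" using weight[OF z] A by (rule mult_left_mono)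
        finally show ?thesis .
      qed
    qed (use r in auto)
    then have "cmod (tc (G n x) j) \<le> A * (K * d) / r ^ j"
      by (simp add: taylor_coeff_def norm_divide norm_fact field_simps)
    then have "1 \<le> A * K * d / r ^ j" using j by (simp add: tc_G mult.assoc)
    then have "r ^ j \<le> A * K * d" using r by (simp add: field_simps)
    moreover have "r ^ n \<le> r ^ j" using r j by (intro power_decreasing) auto
    ultimately show False using d by simp
  qed
  then show ?thesis using s M by (intro exI[of _ "s / M"]) auto
qed

text \<open>Shifting jets upwards is multiplication by a bounded function with the jet of
  \<open>(z - \<theta>) ^ l\<close>, for which \<open>G\<close> itself provides a candidate.\<close>

lemma Phi_shift:
  assumes "m = n + l"
  shows "\<exists>b\<ge>1. \<forall>x. Phi m (\<lambda>j. if l \<le> j \<and> j < m then x (j - l) else 0) \<le> b * Phi n x \<and>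
     Phi n x \<le> b * Phi m (\<lambda>j. if l \<le> j \<and> j < m then x (j - l) else 0)"
proof -
  define emb :: "(nat \<Rightarrow> complex) \<Rightarrow> nat \<Rightarrow> complex" where
    "emb x = (\<lambda>j. if l \<le> j \<and> j < m then x (j - l) else 0)" for x
  obtain A M where A: "A \<ge> 0" and M: "M \<ge> 1" and dom: "\<And>x. dominated A (M * Phi n x) (G n x)"
    using dominated_G[of n] by blast
  obtain A' M' where A': "A' \<ge> 0" and M': "M' \<ge> 1" and dom': "\<And>x. dominated A' (M' * Phi m x) (G m x)"
    using dominated_G[of m] by blast
  obtain r where r: "0 < r" "cball (of_real \<theta>) r \<subseteq> D" using closed_disc_in_D by blast
  define v where "v = G m (\<lambda>j. if j = l then 1 else 0)"
  define s where "s = M' * Phi m (\<lambda>j. if j = l then 1 else 0)"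
  have s: "s \<ge> 0" using M' Phi_nonneg by (simp add: s_def)
  define V where "V = A' * (max 1 (\<psi>0 s) * max 1 (\<psi>1 s))"
  have V: "V \<ge> 0" using A' by (auto simp: V_def)
  have v_le: "cmod (v z) \<le> V" if "z \<in> D" for z
  proof -
    have "cmod (v z) \<le> A' * weight s z" using dominated_le[OF dom' that] by (simp add: v_def s_def)
    also have "\<dots> \<le> V" unfolding V_def using A' s that by (intro mult_left_mono weight_le) auto
    finally show ?thesis .
  qed
  obtain B where B: "B \<ge> 1"
      "\<And>s f x. 0 \<le> s \<Longrightarrow> dominated (V * A) s f \<Longrightarrow> (\<forall>j<m. tc f j = x j) \<Longrightarrow> Phi m x \<le> B * s"
    using Phi_le[of "V * A" m] A V by auto
  obtain B' where B': "B' \<ge> 1"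
      "\<And>s f x. 0 \<le> s \<Longrightarrow> dominated (A' / r ^ l) s f \<Longrightarrow> (\<forall>j<n. tc f j = x j) \<Longrightarrow> Phi n x \<le> B' * s"
    using Phi_le[of "A' / r ^ l" n] A' r by auto
  have up: "Phi m (emb x) \<le> (B * M) * Phi n x" for x
  proof -
    have v: "v holomorphic_on D" by (simp add: v_def G_holo)
    have "dominated (V * A) (M * Phi n x) (\<lambda>z. v z * G n x z)"
      using v_le V v by (intro dominated_mult dom) auto
    moreover have "tc (\<lambda>z. v z * G n x z) j = emb x j" if "j < m" for j
    proof -
      have "tc (\<lambda>z. v z * G n x z) j = (\<Sum>i=0..j. tc v i * tc (G n x) (j - i))"
        by (simp add: taylor_coeff_fps_expansion jet_mult v G_holo fps_mult_nth)
      also have "\<dots> = (\<Sum>i=0..j. if i = l then tc (G n x) (j - i) else 0)"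
        using that by (intro sum.cong) (auto simp: v_def tc_G)
      also have "\<dots> = emb x j" using that assms by (auto simp: emb_def tc_G)
      finally show ?thesis .
    qed
    ultimately have "Phi m (emb x) \<le> B * (M * Phi n x)"
      using M Phi_nonneg[of n x] by (intro B(2)) auto
    then show ?thesis by simp
  qed
  \<comment> \<open>Conversely, the first \<open>l\<close> coefficients of
    \<open>G m (emb x)\<close> vanish, and division by the l-th power of z - \<theta> returns a
    function whose first \<open>n\<close> coefficients are those of \<open>x\<close>.\<close>
  have down: "Phi n x \<le> (B' * M') * Phi m (emb x)" for x
  proof -
    have "\<exists>k. dominated (A' / r ^ l) (M' * Phi m (emb x)) k \<and> (\<forall>j. tc k j = tc (G m (emb x)) (j + l))"
      using M' A' Phi_nonneg[of m "emb x"] assms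
      by (intro dominated_divide r dom') (auto simp: tc_G emb_def)
    then obtain k where k: "dominated (A' / r ^ l) (M' * Phi m (emb x)) k"
      "\<And>j. tc k j = tc (G m (emb x)) (j + l)" by blast
    have "Phi n x \<le> B' * (M' * Phi m (emb x))"
      using M' Phi_nonneg[of m "emb x"] assms
      by (intro B'(2)[OF _ k(1)]) (auto simp: k(2) tc_G emb_def)
    then show ?thesis by simp
  qed
  define b where "b = max (B * M) (B' * M')"
  have "1 * 1 \<le> B * M" using B(1) M by (intro mult_mono) auto
  then have "b \<ge> 1" by (simp add: b_def)
  moreover have "Phi m (emb x) \<le> b * Phi n x" "Phi n x \<le> b * Phi m (emb x)" for x
    using up[of x] down[of x] mult_right_mono[of "B * M" b "Phi n x"]
      mult_right_mono[of "B' * M'" b "Phi m (emb x)"] Phi_nonneg[of n x] Phi_nonneg[of m "emb x"]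
    by (auto simp: b_def)
  ultimately have "1 \<le> b \<and> (\<forall>x. Phi m (emb x) \<le> b * Phi n x \<and> Phi n x \<le> b * Phi m (emb x))"
    by simp
  then show ?thesis unfolding emb_def by (intro exI[of _ b])
qed

end

section \<open>Extension of functionals under quasiconvexity\<close>

text \<open>The coordinate subspace for \<open>J\<close>, kept inside one type so that functionals
  can be extended one coordinate at a time.\<close>

definition supp_in :: "nat set \<Rightarrow> (nat \<Rightarrow> complex) \<Rightarrow> bool" where
  "supp_in J x \<longleftrightarrow> (\<forall>j. j \<notin> J \<longrightarrow> x j = 0)"

definition quasiconvex :: "real \<Rightarrow> ((nat \<Rightarrow> complex) \<Rightarrow> real) \<Rightarrow> bool" where
  "quasiconvex C p \<longleftrightarrow> (\<forall>x y t. 0 \<le> t \<longrightarrow> t \<le> 1 \<longrightarrow>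
     p (\<lambda>j. of_real (1 - t) * x j + of_real t * y j) \<le> C * ((1 - t) * p x + t * p y))"

lemma quasiconvexD:
  "quasiconvex C p \<Longrightarrow> 0 \<le> t \<Longrightarrow> t \<le> 1 \<Longrightarrow>
     p (\<lambda>j. of_real (1 - t) * x j + of_real t * y j) \<le> C * ((1 - t) * p x + t * p y)"
  by (simp add: quasiconvex_def)

lemma quasiconvex_cmult:
  assumes "quasiconvex C p" "0 \<le> a"
  shows "quasiconvex C (\<lambda>x. a * p x)"
  unfolding quasiconvex_def
proof safe
  fix x y :: "nat \<Rightarrow> complex" and t :: real assume t: "0 \<le> t" "t \<le> 1"
  show "a * p (\<lambda>j. of_real (1 - t) * x j + of_real t * y j)
      \<le> C * ((1 - t) * (a * p x) + t * (a * p y))"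
    using mult_left_mono[OF quasiconvexD[OF assms(1) t] assms(2), of x y]
    by (simp add: algebra_simps)
qed

text \<open>The one-dimensional step of the Hahn--Banach theorem; quasiconvexity instead of convexity
  costs a factor \<open>C\<close>.\<close>

lemma quasiconvex_extend_direction:
  fixes f :: "(nat \<Rightarrow> complex) \<Rightarrow> real"
  assumes p: "quasiconvex C p" "\<And>x. 0 \<le> p x" and C: "1 \<le> C"
    and V: "V \<noteq> {}"
      "\<And>x y t. x \<in> V \<Longrightarrow> y \<in> V \<Longrightarrow> 0 \<le> t \<Longrightarrow> t \<le> 1 \<Longrightarrow> (\<lambda>j. of_real (1 - t) * x j + of_real t * y j) \<in> V"
    and f: "\<And>x y t. x \<in> V \<Longrightarrow> y \<in> V \<Longrightarrow> 0 \<le> t \<Longrightarrow> t \<le> 1 \<Longrightarrow>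
        f (\<lambda>j. of_real (1 - t) * x j + of_real t * y j) = (1 - t) * f x + t * f y"
    and le: "\<And>x. x \<in> V \<Longrightarrow> f x \<le> p x + q"
  shows "\<exists>a. \<forall>x\<in>V. \<forall>r::real. f x + r * a \<le> C * p (\<lambda>j. x j + of_real r * d j) + q"
proof -
  \<comment> \<open>For \<open>r \<noteq> 0\<close> the desired inequality says that
    \<open>a\<close> lies above every \<open>L v s\<close> (negative multiples of \<open>d\<close>)
    and below every \<open>U u r\<close> (positive multiples).\<close>
  define L where "L v s = (f v - C * p (\<lambda>j. v j + of_real (- s) * d j) - q) / s" for v and s :: real
  define U where "U u r = (C * p (\<lambda>j. u j + of_real r * d j) + q - f u) / r" for u and r :: real
  have LU: "L v s \<le> U u r" if v: "v \<in> V" and u: "u \<in> V" and s: "0 < s" and r: "0 < r" for u v s r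
  proof -
    \<comment> \<open>With these convex coefficients the \<open>d\<close> components of
      \<open>v'\<close> and \<open>u'\<close> cancel, leaving a point of \<open>V\<close>, where the
      hypothesis on \<open>f\<close> applies.\<close>
    define t where "t = s / (r + s)"
    have t: "0 \<le> t" "t \<le> 1" and t1: "1 - t = r / (r + s)" using s r by (auto simp: t_def field_simps)
    define v' where "v' = (\<lambda>j. v j + of_real (- s) * d j)"
    define u' where "u' = (\<lambda>j. u j + of_real r * d j)"
    have "(1 - t) * s = t * r" using s r unfolding t1 by (simp add: t_def)
    then have cancel: "of_real (1 - t) * of_real s = (of_real t * of_real r :: complex)"
      by (metis of_real_mult)
    have "of_real (1 - t) * v j + of_real t * u j = of_real (1 - t) * v' j + of_real t * u' j" for j
    proof -
      have "of_real (1 - t) * v' j + of_real t * u' j = of_real (1 - t) * v j + of_real t * u j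
        - (of_real (1 - t) * of_real s) * d j + (of_real t * of_real r) * d j"
        by (simp add: v'_def u'_def ring_distribs mult.assoc del: of_real_diff)
      then show ?thesis unfolding cancel by simp
    qed
    then have eq: "(\<lambda>j. of_real (1 - t) * v j + of_real t * u j) = (\<lambda>j. of_real (1 - t) * v' j + of_real t * u' j)"
      by blast
    have "(1 - t) * f v + t * f u \<le> p (\<lambda>j. of_real (1 - t) * v j + of_real t * u j) + q"
      using le[OF V(2)[OF v u t]] f[OF v u t] by simp
    also have "\<dots> \<le> C * ((1 - t) * p v' + t * p u') + q"
      unfolding eq using quasiconvexD[OF p(1) t] by simp
    finally have "(r + s) * ((1 - t) * f v + t * f u) \<le> (r + s) * (C * ((1 - t) * p v' + t * p u') + q)"
      using s r by (intro mult_left_mono) auto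
    moreover have "(r + s) * (1 - t) = r" "(r + s) * t = s" using s r unfolding t1 by (simp_all add: t_def)
    then have "(r + s) * ((1 - t) * X + t * Y) = r * X + s * Y" for X Y
      by (metis distrib_left mult.assoc)
    moreover have "(r + s) * (C * ((1 - t) * X + t * Y) + q) = C * ((r + s) * ((1 - t) * X + t * Y)) + (r + s) * q" for X Y
      by (simp add: algebra_simps)
    ultimately have "r * f v + s * f u \<le> C * (r * p v' + s * p u') + (r + s) * q" by metis
    then have "r * (f v - C * p v' - q) \<le> s * (C * p u' + q - f u)" by (simp add: algebra_simps)
    then show ?thesis using s r by (simp add: L_def U_def v'_def u'_def field_simps)
  qed
  obtain v0 where v0: "v0 \<in> V" using V(1) by blast
  define a where "a = Sup {L v s |v s. v \<in> V \<and> 0 < s}"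
  have ne: "{L v s |v s. v \<in> V \<and> 0 < s} \<noteq> {}" using v0 zero_less_one by blast
  have bdd: "bdd_above {L v s |v s. v \<in> V \<and> 0 < s}"
    unfolding bdd_above_def using LU[OF _ v0 _ zero_less_one] by blast
  have aL: "L v s \<le> a" if "v \<in> V" "0 < s" for v s
    unfolding a_def using that by (intro cSup_upper bdd) auto
  have aU: "a \<le> U u r" if "u \<in> V" "0 < r" for u r
    unfolding a_def using that LU by (intro cSup_least ne) auto
  have "f x + r * a \<le> C * p (\<lambda>j. x j + of_real r * d j) + q" if x: "x \<in> V" for x r
  proof -
    consider "r = 0" | "r > 0" | "r < 0" by linarith
    then show ?thesis
    proof cases
      case 1
      have "1 * p x \<le> C * p x" using C p(2) by (intro mult_right_mono) auto
      then show ?thesis using le[OF x] 1 by simp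
    next
      case 2
      then show ?thesis using aU[OF x 2] by (simp add: U_def field_simps)
    next
      case 3
      then show ?thesis using aL[OF x, of "- r"] by (simp add: L_def field_simps)
    qed
  qed
  then show ?thesis by blast
qed

definition pairing :: "nat set \<Rightarrow> (nat \<Rightarrow> complex) \<Rightarrow> (nat \<Rightarrow> complex) \<Rightarrow> complex" where
  "pairing J \<xi> x = (\<Sum>j\<in>J. \<xi> j * x j)"

lemma pairing_add: "pairing J \<xi> (\<lambda>j. x j + y j) = pairing J \<xi> x + pairing J \<xi> y"
  and pairing_cmult: "pairing J \<xi> (\<lambda>j. c * x j) = c * pairing J \<xi> x"
  by (simp_all add: pairing_def sum.distrib sum_distrib_left algebra_simps)

text \<open>A complex coordinate amounts to two real directions, first 1 and then \<i>, each costing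
  a factor \<open>C\<close>. The additive term \<open>q\<close> is not multiplied, because convex
  coefficients sum to 1.\<close>

lemma quasiconvex_extend_coordinate:
  assumes p: "quasiconvex C p" "\<And>x. 0 \<le> p x" and C: "1 \<le> C"
    and J: "finite J" "i \<notin> J"
    and le: "\<And>x. supp_in J x \<Longrightarrow> Re (pairing J \<xi> x) \<le> p x + q"
  shows "\<exists>\<xi>'. (\<forall>j\<in>J. \<xi>' j = \<xi> j) \<and>
    (\<forall>x. supp_in (insert i J) x \<longrightarrow> Re (pairing (insert i J) \<xi>' x) \<le> C\<^sup>2 * p x + q)"
proof -
  define e where "e c = (\<lambda>j. if j = i then c else 0)" for c :: complex
  have "\<exists>a. \<forall>x\<in>{x. supp_in J x}. \<forall>r::real.
      Re (pairing J \<xi> x) + r * a \<le> C * p (\<lambda>j. x j + of_real r * e 1 j) + q"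
  proof (rule quasiconvex_extend_direction[OF p C])
    show "{x. supp_in J x} \<noteq> {}" by (auto simp: supp_in_def intro!: exI[of _ "\<lambda>_. 0"])
  qed (auto simp: supp_in_def pairing_add pairing_cmult le simp del: of_real_diff)
  then obtain a where a: "\<And>x r. supp_in J x \<Longrightarrow>
      Re (pairing J \<xi> x) + r * a \<le> C * p (\<lambda>j. x j + of_real r * e 1 j) + q" by auto
  \<comment> \<open>The real span of the old coordinates and the direction 1, from which the second
    real extension starts.\<close>
  define V where "V = {x. supp_in (insert i J) x \<and> Im (x i) = 0}"
  have "\<exists>b. \<forall>x\<in>V. \<forall>r::real.
      (Re (pairing J \<xi> x) + Re (x i) * a) + r * b \<le> C * (C * p (\<lambda>j. x j + of_real r * e \<i> j)) + q"
  proof (rule quasiconvex_extend_direction[OF quasiconvex_cmult[OF p(1)] _ C])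
    show "V \<noteq> {}" by (auto simp: V_def supp_in_def intro!: exI[of _ "\<lambda>_. 0"])
    show "Re (pairing J \<xi> x) + Re (x i) * a \<le> C * p x + q" if x: "x \<in> V" for x
    proof -
      define y where "y = (\<lambda>j. if j = i then 0 else x j)"
      have "pairing J \<xi> y = pairing J \<xi> x"
        unfolding pairing_def using J by (intro sum.cong) (auto simp: y_def)
      moreover have "(\<lambda>j. y j + of_real (Re (x i)) * e 1 j) = x"
        using x by (auto simp: y_def e_def V_def complex_eq_iff)
      moreover have "supp_in J y" using x by (auto simp: V_def supp_in_def y_def)
      ultimately show ?thesis using a[of y "Re (x i)"] by simp
    qed
    show "(Re (pairing J \<xi> (\<lambda>j. of_real (1 - t) * x j + of_real t * y j)) +
          Re (of_real (1 - t) * x i + of_real t * y i) * a) =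
        (1 - t) * (Re (pairing J \<xi> x) + Re (x i) * a) + t * (Re (pairing J \<xi> y) + Re (y i) * a)"
      for x y :: "nat \<Rightarrow> complex" and t
      unfolding pairing_add pairing_cmult by (simp add: algebra_simps)
  qed (use C p(2) in \<open>auto simp: V_def supp_in_def\<close>)
  then obtain b where b: "\<And>x r. x \<in> V \<Longrightarrow>
      (Re (pairing J \<xi> x) + Re (x i) * a) + r * b \<le> C * (C * p (\<lambda>j. x j + of_real r * e \<i> j)) + q" by auto
  \<comment> \<open>Multiplication of \<open>z\<close> by \<open>Complex a (- b)\<close> has real
    part \<open>a * Re z + b * Im z\<close>, so one complex coefficient encodes both real
    slopes.\<close>
  define \<xi>' where "\<xi>' = \<xi>(i := Complex a (- b))"
  have "Re (pairing (insert i J) \<xi>' x) \<le> C\<^sup>2 * p x + q" if x: "supp_in (insert i J) x" for x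
  proof -
    define y where "y = x(i := of_real (Re (x i)))"
    have y: "y \<in> V" using x by (auto simp: V_def y_def supp_in_def)
    have "pairing J \<xi>' x = pairing J \<xi> x"
      unfolding pairing_def using J by (intro sum.cong) (auto simp: \<xi>'_def)
    moreover have "pairing J \<xi> x = pairing J \<xi> y"
      unfolding pairing_def using J by (intro sum.cong) (auto simp: y_def)
    ultimately have "Re (pairing (insert i J) \<xi>' x) = (Re (pairing J \<xi> y) + Re (y i) * a) + Im (x i) * b"
      using J by (simp add: pairing_def \<xi>'_def y_def)
    also have "\<dots> \<le> C * (C * p (\<lambda>j. y j + of_real (Im (x i)) * e \<i> j)) + q" by (rule b[OF y])
    also have "(\<lambda>j. y j + of_real (Im (x i)) * e \<i> j) = x"
      by (auto simp: y_def e_def complex_eq_iff)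
    finally show ?thesis by (simp add: power2_eq_square mult.assoc)
  qed
  then show ?thesis using J by (intro exI[of _ \<xi>'] conjI) (auto simp: \<xi>'_def)
qed

lemma quasiconvex_extend:
  assumes p: "quasiconvex C p" "\<And>x. 0 \<le> p x" and C: "1 \<le> C"
    and "finite I" "finite J" "I \<inter> J = {}"
    and le: "\<And>x. supp_in J x \<Longrightarrow> Re (pairing J \<xi> x) \<le> p x + q"
  shows "\<exists>\<xi>'. (\<forall>j\<in>J. \<xi>' j = \<xi> j) \<and>
    (\<forall>x. supp_in (I \<union> J) x \<longrightarrow> Re (pairing (I \<union> J) \<xi>' x) \<le> C ^ (2 * card I) * p x + q)"
  using \<open>finite I\<close> \<open>I \<inter> J = {}\<close>
proof (induction I)
  case empty
  then show ?case using le by (intro exI[of _ \<xi>]) auto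
next
  case (insert i I)
  then obtain \<eta> where \<eta>: "\<forall>j\<in>J. \<eta> j = \<xi> j"
    "\<And>x. supp_in (I \<union> J) x \<Longrightarrow> Re (pairing (I \<union> J) \<eta> x) \<le> C ^ (2 * card I) * p x + q" by auto
  have "\<exists>\<xi>'. (\<forall>j\<in>I \<union> J. \<xi>' j = \<eta> j) \<and>
    (\<forall>x. supp_in (insert i (I \<union> J)) x \<longrightarrow>
      Re (pairing (insert i (I \<union> J)) \<xi>' x) \<le> C\<^sup>2 * (C ^ (2 * card I) * p x) + q)"
    using insert assms C
    by (intro quasiconvex_extend_coordinate quasiconvex_cmult[OF p(1)] \<eta>(2)) auto
  then obtain \<xi>' where \<xi>': "\<forall>j\<in>I \<union> J. \<xi>' j = \<eta> j"
    "\<And>x. supp_in (insert i (I \<union> J)) x \<Longrightarrow>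
      Re (pairing (insert i (I \<union> J)) \<xi>' x) \<le> C\<^sup>2 * (C ^ (2 * card I) * p x) + q" by blast
  have "C\<^sup>2 * (C ^ (2 * card I) * X) = C ^ (2 * card (insert i I)) * X" for X
    using insert by (simp add: power2_eq_square)
  from \<xi>'(2)[unfolded this] show ?case using \<xi>'(1) \<eta>(1) by (intro exI[of _ \<xi>']) auto
qed

section \<open>Gluing functionals continuously over the interval [0,1]\<close>

lemma partition_of_unity_01:
  assumes r: "0 < r"
  shows "\<exists>N. \<exists>h :: nat \<Rightarrow> real \<Rightarrow> real.
    (\<forall>i<N. continuous_on {0..1} (h i)) \<and>
    (\<forall>t\<in>{0..1}. (\<forall>i<N. 0 \<le> h i t) \<and> (\<Sum>i<N. h i t) = 1) \<and>
    (\<forall>i<N. \<forall>s t. h i s \<noteq> 0 \<longrightarrow> h i t \<noteq> 0 \<longrightarrow> \<bar>s - t\<bar> < r)"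
proof -
  obtain n where "2 / r < real n" using reals_Archimedean2 by blast
  moreover have "0 < 2 / r" using r by simp
  ultimately have n: "0 < real n" by linarith
  then have nr: "2 / real n < r" using \<open>2 / r < real n\<close> r by (simp add: field_simps)
  define N where "N = Suc n"
  \<comment> \<open>Tents of half-width 1/n at the nodes i/n; two points under one tent are less
    than 2/n < r apart. There are \<open>n + 1\<close> nodes, as both endpoints count.\<close>
  define g where "g i t = max 0 (1 / real n - \<bar>t - real i / real n\<bar>)" for i t
  define H where "H t = (\<Sum>i<N. g i t)" for t
  define h where "h i t = g i t / H t" for i t
  have g: "0 \<le> g i t" for i t by (simp add: g_def)
  have H: "0 < H t" if t: "t \<in> {0..1}" for t
  proof -
    \<comment> \<open>The node just left of \<open>t\<close> is closer than 1/n, so its tent is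
      positive at \<open>t\<close>.\<close>
    define i where "i = nat \<lfloor>real n * t\<rfloor>"
    have i: "real i \<le> real n * t" "real n * t < real i + 1"
      using t n by (auto simp: i_def)
    have "real n * t \<le> real n * 1" using t by (intro mult_left_mono) auto
    then have "i < N" using i(1) by (simp add: N_def)
    moreover have "\<bar>t - real i / real n\<bar> < 1 / real n"
    proof -
      have "\<bar>real n * t - real i\<bar> < 1" using i by linarith
      moreover have "t - real i / real n = (real n * t - real i) / real n"
        using n by (simp add: field_simps)
      ultimately show ?thesis using n by (simp add: divide_strict_right_mono)
    qed
    then have "0 < g i t" by (simp add: g_def)
    ultimately show ?thesis unfolding H_def using g by (intro sum_pos2) auto
  qed
  have cont_g: "continuous_on {0..1} (g i)" for i
    unfolding g_def by (intro continuous_intros)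
  have "continuous_on {0..1} (h i)" for i
    unfolding h_def H_def
    by (intro continuous_intros cont_g ballI) (use H in \<open>force simp: H_def\<close>)
  moreover have "0 \<le> h i t" if "t \<in> {0..1}" for i t
    using H[OF that] g by (simp add: h_def)
  moreover have "(\<Sum>i<N. h i t) = 1" if "t \<in> {0..1}" for t
    using H[OF that] unfolding h_def by (simp add: H_def flip: sum_divide_distrib)
  moreover have "\<bar>s - t\<bar> < r" if "h i s \<noteq> 0" "h i t \<noteq> 0" for i s t
  proof -
    have "\<bar>s - real i / real n\<bar> < 1 / real n" "\<bar>t - real i / real n\<bar> < 1 / real n"
      using that by (auto simp: h_def g_def max_def split: if_splits)
    then have "\<bar>s - t\<bar> < 2 / real n" by (simp add: abs_less_iff)
    then show ?thesis using nr by simp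
  qed
  ultimately show ?thesis by (intro exI[of _ N] exI[of _ h]) simp
qed

text \<open>\<open>scale\<close> merges \<Delta>2 with rotation invariance up to a constant;
  \<open>coercive\<close> is a uniform lower bound which, together with quasiconvexity, yields at
  least linear growth in each of the \<open>n\<close> coordinates.\<close>

locale quasi_young =
  fixes n :: nat and \<phi> :: "(nat \<Rightarrow> complex) \<Rightarrow> real" and C :: real
  assumes nonneg: "0 \<le> \<phi> x"
    and zero: "\<phi> (\<lambda>_. 0) = 0"
    and C: "1 \<le> C" and qconvex: "quasiconvex C \<phi>"
    and scale: "\<exists>M\<ge>0. \<forall>c x. cmod c \<le> R \<longrightarrow> \<phi> (\<lambda>j. c * x j) \<le> M * \<phi> x"
    and coercive: "\<exists>c>0. \<forall>x. (\<exists>j<n. 1 \<le> cmod (x j)) \<longrightarrow> c \<le> \<phi> x"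
begin

lemma shrink:
  assumes "1 \<le> \<rho>"
  shows "\<phi> (\<lambda>j. x j / of_real \<rho>) \<le> C * \<phi> x / \<rho>"
  using quasiconvexD[OF qconvex, of "1 / \<rho>" "\<lambda>_. 0" x] assms by (simp add: zero field_simps)

text \<open>Scaling a coordinate of modulus \<rho> > 1 down to modulus 1 divides
  \<open>\<phi>\<close> by \<rho> up to the factor \<open>C\<close>, whereas coercivity keeps the
  result above \<open>c\<close>.\<close>

lemma coordinate_le:
  "\<exists>c>0. \<forall>x. \<forall>j<n. cmod (x j) \<le> 1 + c * \<phi> x"
proof -
  obtain c where c: "c > 0" "\<And>x. (\<exists>j<n. 1 \<le> cmod (x j)) \<Longrightarrow> c \<le> \<phi> x"
    using coercive by blast
  have "cmod (x j) \<le> 1 + (C / c) * \<phi> x" if j: "j < n" for x j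
  proof (cases "cmod (x j) \<le> 1")
    case True
    moreover have "0 \<le> (C / c) * \<phi> x" using C c nonneg by (intro mult_nonneg_nonneg) auto
    ultimately show ?thesis by linarith
  next
    case False
    define \<rho> where "\<rho> = cmod (x j)"
    have \<rho>: "1 \<le> \<rho>" using False by (simp add: \<rho>_def)
    have "cmod (x j / of_real \<rho>) = 1" using \<rho> by (simp add: norm_divide flip: \<rho>_def)
    then have "c \<le> \<phi> (\<lambda>j. x j / of_real \<rho>)" using j by (intro c(2)) auto
    also have "\<dots> \<le> C * \<phi> x / \<rho>" by (rule shrink[OF \<rho>])
    finally show ?thesis using \<rho> c(1) by (simp add: field_simps flip: \<rho>_def)
  qed
  then show ?thesis using c C by (intro exI[of _ "C / c"]) auto
qed

text \<open>Linear growth lets \<open>\<phi>\<close> dominate every functional with small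
  coefficients. This later absorbs the oscillation of \<open>Y\<close> between a point and its
  node.\<close>

lemma small_functional:
  assumes "0 < e"
  shows "\<exists>\<delta>>0. \<forall>\<eta> x. (\<forall>j<n. cmod (\<eta> j) \<le> \<delta>) \<longrightarrow> cmod (pairing {..<n} \<eta> x) \<le> \<phi> x + e"
proof -
  obtain c where c: "c > 0" "\<And>x j. j < n \<Longrightarrow> cmod (x j) \<le> 1 + c * \<phi> x"
    using coordinate_le by blast
  \<comment> \<open>One bound serves the constant term of \<open>coordinate_le\<close>, the other
    its multiple of \<open>\<phi>\<close>; \<open>n + 1\<close> is nonzero also when
    \<open>n = 0\<close>.\<close>
  define \<delta> where "\<delta> = min (e / (n + 1)) (1 / (c * (n + 1)))"
  have d: "n * \<delta> \<le> e" "n * \<delta> * c \<le> 1" "0 < \<delta>"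
  proof -
    have "\<delta> \<le> e / (n + 1)" "\<delta> \<le> 1 / (c * (n + 1))" by (auto simp: \<delta>_def)
    then have "(n + 1) * \<delta> \<le> e" "(n + 1) * \<delta> * c \<le> 1"
      using c(1) by (simp_all add: pos_le_divide_eq mult_ac)
    moreover show d0: "0 < \<delta>" using assms c(1) by (simp add: \<delta>_def)
    then have "n * \<delta> \<le> (n + 1) * \<delta>" by (intro mult_right_mono) auto
    moreover from this have "n * \<delta> * c \<le> (n + 1) * \<delta> * c"
      by (rule mult_right_mono) (use c(1) in simp)
    ultimately show "n * \<delta> \<le> e" "n * \<delta> * c \<le> 1" by linarith+
  qed
  have "cmod (pairing {..<n} \<eta> x) \<le> \<phi> x + e" if \<eta>: "\<forall>j<n. cmod (\<eta> j) \<le> \<delta>" for \<eta> x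
  proof -
    have "cmod (pairing {..<n} \<eta> x) \<le> (\<Sum>j<n. \<delta> * (1 + c * \<phi> x))"
      unfolding pairing_def
      by (intro sum_norm_le) (use \<eta> c d(3) in \<open>auto simp: norm_mult intro!: mult_mono\<close>)
    also have "\<dots> = n * \<delta> + (n * \<delta> * c) * \<phi> x" by (simp add: algebra_simps)
    also have "\<dots> \<le> e + 1 * \<phi> x" using d nonneg by (intro add_mono mult_right_mono) auto
    finally show ?thesis by simp
  qed
  then show ?thesis using d(3) by blast
qed

text \<open>Extending the functionals \<open>Y(t)\<close> one at a time gives no continuity in \<open>t\<close>. The extensions
  at finitely many nodes are glued by a partition of unity; the node chosen in each piece almost
  minimises \<open>q\<close> there, so that no regularity of \<open>q\<close> is needed.\<close>

lemma continuous_extension: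
  assumes l: "l \<le> n" and \<kappa>: "0 \<le> \<kappa>" and e: "0 < e"
    and Y: "\<And>j. j \<in> {l..<n} \<Longrightarrow> continuous_on {0..1} (Y j :: real \<Rightarrow> complex)"
    and q: "\<And>t. t \<in> {0..1} \<Longrightarrow> 0 \<le> (q t :: real)"
    and le: "\<And>t x. t \<in> {0..1} \<Longrightarrow> supp_in {l..<n} x \<Longrightarrow>
       Re (pairing {l..<n} (\<lambda>j. Y j t) x) \<le> \<kappa> * \<phi> x + q t"
  shows "\<exists>\<xi>. (\<forall>j<n. continuous_on {0..1} (\<xi> j)) \<and> (\<forall>j\<in>{l..<n}. \<forall>t\<in>{0..1}. \<xi> j t = Y j t) \<and>
    (\<forall>t\<in>{0..1}. \<forall>x. supp_in {..<n} x \<longrightarrow>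
      Re (pairing {..<n} (\<lambda>j. \<xi> j t) x) \<le> (C ^ (2 * l) * \<kappa> + 1) * \<phi> x + q t + e)"
proof -
  obtain \<delta> where \<delta>: "\<delta> > 0"
      "\<And>\<eta> x. (\<forall>j<n. cmod (\<eta> j) \<le> \<delta>) \<Longrightarrow> cmod (pairing {..<n} \<eta> x) \<le> \<phi> x + e / 2"
    using small_functional[of "e / 2"] e by auto
  have "\<exists>r>0. \<forall>s\<in>{0..1}. \<forall>t\<in>{0..1}. \<bar>s - t\<bar> < r \<longrightarrow> cmod (Y j s - Y j t) < \<delta>" if "j \<in> {l..<n}" for j
  proof -
    have "uniformly_continuous_on {0..1} (Y j)"
      using Y[OF that] by (intro compact_uniformly_continuous) auto
    then show ?thesis using \<delta>(1) unfolding uniformly_continuous_on_def dist_norm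
      by (metis norm_minus_commute real_norm_def)
  qed
  then obtain R where R: "\<And>j. j \<in> {l..<n} \<Longrightarrow> R j > 0"
    "\<And>j s t. j \<in> {l..<n} \<Longrightarrow> s \<in> {0..1} \<Longrightarrow> t \<in> {0..1} \<Longrightarrow> \<bar>s - t\<bar> < R j \<Longrightarrow> cmod (Y j s - Y j t) < \<delta>"
    by metis
  \<comment> \<open>The 1 keeps the minimum over a nonempty set when \<open>l = n\<close>.\<close>
  define r where "r = Min (insert 1 (R ` {l..<n}))"
  have r: "r > 0" using R(1) by (auto simp: r_def)
  have rR: "r \<le> R j" if "j \<in> {l..<n}" for j
    unfolding r_def using that by (intro Min_le) auto
  obtain N :: nat and h :: "nat \<Rightarrow> real \<Rightarrow> real" where
    H: "\<forall>i<N. continuous_on {0..1} (h i)"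
      "\<forall>t\<in>{0..1}. (\<forall>i<N. 0 \<le> h i t) \<and> (\<Sum>i<N. h i t) = 1"
      "\<forall>i<N. \<forall>s t. h i s \<noteq> 0 \<longrightarrow> h i t \<noteq> 0 \<longrightarrow> \<bar>s - t\<bar> < r"
    using partition_of_unity_01[OF r] by (elim exE conjE)
  have hc: "continuous_on {0..1} (h i)" if "i < N" for i
    using H(1) that by blast
  have h0: "0 \<le> h i t" if "t \<in> {0..1}" "i < N" for i t
    using H(2) that by blast
  have h1: "(\<Sum>i<N. h i t) = 1" if "t \<in> {0..1}" for t
    using H(2) that by blast
  have hr: "\<bar>s - t\<bar> < r" if "i < N" "h i s \<noteq> 0" "h i t \<noteq> 0" for i s t
    using H(3) that by blast
  \<comment> \<open>The slack \<open>e / 2\<close> replaces attainment of the infimum of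
    \<open>q\<close>; 0 is a dummy node for a bump that vanishes on the interval.\<close>
  have "\<exists>\<tau>. \<tau> \<in> {0..1} \<and> (\<forall>t\<in>{0..1}. h i t \<noteq> 0 \<longrightarrow> h i \<tau> \<noteq> 0 \<and> q \<tau> \<le> q t + e / 2)" for i
  proof (cases "\<exists>t\<in>{0..1}. h i t \<noteq> 0")
    case True
    define Q where "Q = q ` {t\<in>{0..1}. h i t \<noteq> 0}"
    have Qne: "Q \<noteq> {}" and Qbdd: "bdd_below Q"
      using True q by (auto simp: Q_def bdd_below_def)
    have "\<exists>x\<in>Q. x < Inf Q + e / 2" using Qne Qbdd e by (subst cInf_less_iff[symmetric]) auto
    then obtain \<tau> where \<tau>: "\<tau> \<in> {0..1}" "h i \<tau> \<noteq> 0" "q \<tau> < Inf Q + e / 2" by (auto simp: Q_def)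
    have "q \<tau> \<le> q t + e / 2" if "t \<in> {0..1}" "h i t \<noteq> 0" for t
    proof -
      have "Inf Q \<le> q t" using Qbdd that by (intro cInf_lower) (auto simp: Q_def)
      then show ?thesis using \<tau> by simp
    qed
    then show ?thesis using \<tau> by blast
  next
    case False
    then show ?thesis by (intro exI[of _ 0]) auto
  qed
  then obtain \<tau> where \<tau>: "\<And>i. \<tau> i \<in> {0..1}"
    "\<And>i t. t \<in> {0..1} \<Longrightarrow> h i t \<noteq> 0 \<Longrightarrow> h i (\<tau> i) \<noteq> 0"
    "\<And>i t. t \<in> {0..1} \<Longrightarrow> h i t \<noteq> 0 \<Longrightarrow> q (\<tau> i) \<le> q t + e / 2" by metis
  have split: "{..<l} \<union> {l..<n} = {..<n}" using l by auto
  have "\<exists>\<zeta>. (\<forall>j\<in>{l..<n}. \<zeta> j = Y j (\<tau> i)) \<and>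
      (\<forall>x. supp_in {..<n} x \<longrightarrow> Re (pairing {..<n} \<zeta> x) \<le> C ^ (2 * l) * (\<kappa> * \<phi> x) + q (\<tau> i))" for i
    using quasiconvex_extend[OF quasiconvex_cmult[OF qconvex \<kappa>] _ C, of "{..<l}" "{l..<n}" "\<lambda>j. Y j (\<tau> i)" "q (\<tau> i)"]
      le[OF \<tau>(1)] \<kappa> nonneg by (simp add: split ivl_disj_int)
  then obtain \<zeta> where \<zeta>: "\<And>i j. j \<in> {l..<n} \<Longrightarrow> \<zeta> i j = Y j (\<tau> i)"
    "\<And>i x. supp_in {..<n} x \<Longrightarrow> Re (pairing {..<n} (\<zeta> i) x) \<le> C ^ (2 * l) * (\<kappa> * \<phi> x) + q (\<tau> i)"
    by metis
  \<comment> \<open>Only the new coordinates \<open>j < l\<close> are averaged over the nodes. The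
    old ones must equal \<open>Y\<close> exactly, so \<open>\<eta>\<close> records the difference
    between \<open>Y\<close> at \<open>t\<close> and \<open>Y\<close> at the node.\<close>
  define \<xi> where "\<xi> j t = (if j < l then \<Sum>i<N. of_real (h i t) * \<zeta> i j else Y j t)" for j t
  define \<eta> where "\<eta> i t j = (if j < l then 0 else Y j t - Y j (\<tau> i))" for i t j
  have decomp: "\<xi> j t = (\<Sum>i<N. of_real (h i t) * (\<zeta> i j + \<eta> i t j))" if "t \<in> {0..1}" "j < n" for j t
  proof (cases "j < l")
    case False
    then have "(\<Sum>i<N. of_real (h i t) * (\<zeta> i j + \<eta> i t j)) = (\<Sum>i<N. of_real (h i t) * Y j t)"
      using \<zeta>(1)[of j] that(2) by (intro sum.cong) (auto simp: \<eta>_def)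
    also have "\<dots> = of_real (\<Sum>i<N. h i t) * Y j t" by (simp add: sum_distrib_right)
    finally show ?thesis using False h1[OF that(1)] by (simp add: \<xi>_def)
  qed (simp add: \<xi>_def \<eta>_def)
  have "Re (pairing {..<n} (\<lambda>j. \<xi> j t) x) \<le> (C ^ (2 * l) * \<kappa> + 1) * \<phi> x + q t + e"
    if t: "t \<in> {0..1}" and x: "supp_in {..<n} x" for t x
  proof -
    have "pairing {..<n} (\<lambda>j. \<xi> j t) x = (\<Sum>j<n. \<Sum>i<N. of_real (h i t) * (\<zeta> i j + \<eta> i t j) * x j)"
      unfolding pairing_def using t by (intro sum.cong) (auto simp: decomp sum_distrib_right)
    also have "\<dots> = (\<Sum>i<N. of_real (h i t) * (pairing {..<n} (\<zeta> i) x + pairing {..<n} (\<eta> i t) x))"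
      by (subst sum.swap) (simp add: pairing_def sum_distrib_left sum.distrib algebra_simps)
    finally have "Re (pairing {..<n} (\<lambda>j. \<xi> j t) x)
        = (\<Sum>i<N. h i t * (Re (pairing {..<n} (\<zeta> i) x) + Re (pairing {..<n} (\<eta> i t) x)))"
      by simp
    also have "\<dots> \<le> (\<Sum>i<N. h i t * ((C ^ (2 * l) * \<kappa> + 1) * \<phi> x + q t + e))"
    proof (intro sum_mono)
      fix i assume i: "i \<in> {..<N}"
      show "h i t * (Re (pairing {..<n} (\<zeta> i) x) + Re (pairing {..<n} (\<eta> i t) x))
          \<le> h i t * ((C ^ (2 * l) * \<kappa> + 1) * \<phi> x + q t + e)"
      proof (cases "h i t = 0")
        case False
        have "cmod (\<eta> i t j) \<le> \<delta>" if "j < n" for j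
        proof (cases "j < l")
          case False
          have "\<bar>t - \<tau> i\<bar> < r" using i \<open>h i t \<noteq> 0\<close> \<tau>(2)[OF t] by (intro hr) auto
          then have "cmod (Y j t - Y j (\<tau> i)) < \<delta>"
            using False that rR[of j] by (intro R(2) t \<tau>(1)) auto
          then show ?thesis using False by (simp add: \<eta>_def)
        qed (use \<delta>(1) in \<open>simp add: \<eta>_def\<close>)
        then have "Re (pairing {..<n} (\<eta> i t) x) \<le> \<phi> x + e / 2"
          using \<delta>(2)[of "\<eta> i t" x] complex_Re_le_cmod order_trans by blast
        moreover have "Re (pairing {..<n} (\<zeta> i) x) \<le> C ^ (2 * l) * (\<kappa> * \<phi> x) + (q t + e / 2)"
          using \<zeta>(2)[OF x, of i] \<tau>(3)[OF t False] by linarith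
        ultimately have "Re (pairing {..<n} (\<zeta> i) x) + Re (pairing {..<n} (\<eta> i t) x)
            \<le> (C ^ (2 * l) * \<kappa> + 1) * \<phi> x + q t + e" by (simp add: algebra_simps)
        then show ?thesis using h0[OF t] i by (intro mult_left_mono) auto
      qed simp
    qed
    also have "\<dots> = (\<Sum>i<N. h i t) * ((C ^ (2 * l) * \<kappa> + 1) * \<phi> x + q t + e)"
      by (simp only: sum_distrib_right)
    also have "\<dots> = (C ^ (2 * l) * \<kappa> + 1) * \<phi> x + q t + e" by (simp add: h1[OF t])
    finally show ?thesis .
  qed
  moreover have "continuous_on {0..1} (\<xi> j)" if "j < n" for j
    using that Y[of j] hc by (cases "j < l") (auto simp: \<xi>_def[abs_def] intro!: continuous_intros)
  ultimately show ?thesis by (intro exI[of _ \<xi>]) (auto simp: \<xi>_def)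
qed

end

section \<open>Operators on Fenchel--Orlicz spaces\<close>

definition luxemburg_bound :: "((nat \<Rightarrow> complex) \<Rightarrow> real) \<Rightarrow> vseq \<Rightarrow> real \<Rightarrow> bool" where
  "luxemburg_bound \<phi> X \<rho> \<longleftrightarrow> \<rho> > 0 \<and> summable (\<lambda>k. \<phi> (\<lambda>j. X k j / complex_of_real \<rho>)) \<and>
     (\<Sum>k. \<phi> (\<lambda>j. X k j / complex_of_real \<rho>)) \<le> 1"

lemma luxemburg_eq: "luxemburg \<phi> X = Inf {\<rho>. luxemburg_bound \<phi> X \<rho>}"
  by (simp add: luxemburg_def luxemburg_bound_def)

lemma luxemburg_le: "luxemburg_bound \<phi> X \<rho> \<Longrightarrow> luxemburg \<phi> X \<le> \<rho>"
  unfolding luxemburg_eq by (intro cInf_lower bdd_belowI[of _ 0]) (auto simp: luxemburg_bound_def)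

lemma le_luxemburg:
  assumes "luxemburg_bound \<phi> X \<rho>" "\<And>\<rho>. luxemburg_bound \<phi> X \<rho> \<Longrightarrow> a \<le> \<rho>"
  shows "a \<le> luxemburg \<phi> X"
  unfolding luxemburg_eq using assms by (intro cInf_greatest) auto

lemma le_mult_luxemburg:
  assumes "luxemburg_bound \<phi> X \<rho>" "0 \<le> b" "\<And>\<rho>. luxemburg_bound \<phi> X \<rho> \<Longrightarrow> a \<le> b * \<rho>"
  shows "a \<le> b * luxemburg \<phi> X"
proof (cases "b = 0")
  case True
  then show ?thesis using assms(3)[OF assms(1)] by simp
next
  case False
  then have "a / b \<le> luxemburg \<phi> X"
    using assms by (intro le_luxemburg[OF assms(1)]) (auto simp: field_simps)
  then show ?thesis using False assms(2) by (simp add: field_simps)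
qed

definition head_part :: "nat \<Rightarrow> vseq \<Rightarrow> vseq" where
  "head_part N X = (\<lambda>k j. if k < N then X k j else 0)"

definition tail_part :: "nat \<Rightarrow> vseq \<Rightarrow> vseq" where
  "tail_part N X = (\<lambda>k j. if k < N then 0 else X k j)"

lemma tail_part_eq: "tail_part N X k = (if k < N then (\<lambda>_. 0) else X k)"
  by (simp add: tail_part_def)

context quasi_young
begin

abbreviation E :: "vseq set" where "E \<equiv> fenchel_orlicz n \<phi>"

lemma E_supp: "X \<in> E \<Longrightarrow> supp_in {..<n} (X k)"
  by (auto simp: fenchel_orlicz_def supp_in_def)

lemma E_eq_0: "X \<in> E \<Longrightarrow> n \<le> j \<Longrightarrow> X k j = 0"
  by (auto simp: fenchel_orlicz_def)

lemma E_I: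
  assumes "\<And>k. supp_in {..<n} (X k)" "summable (\<lambda>k. \<phi> (X k))"
  shows "X \<in> E"
  unfolding fenchel_orlicz_def using assms by (auto simp: supp_in_def intro!: exI[of _ 1])

text \<open>\<Delta>2 at work: summability for one \<rho> gives summability for every multiple, so
  that in \<open>E\<close> the sum of \<open>\<phi> (X k)\<close> itself may be used.\<close>

lemma summable_scale:
  assumes "X \<in> E"
  shows "summable (\<lambda>k. \<phi> (\<lambda>j. c * X k j))"
proof -
  obtain \<rho> :: real where \<rho>: "\<rho> > 0" "summable (\<lambda>k. \<phi> (\<lambda>j. X k j / of_real \<rho>))"
    using assms by (auto simp: fenchel_orlicz_def)
  obtain M where M: "\<And>a x. cmod a \<le> cmod (c * of_real \<rho>) \<Longrightarrow> \<phi> (\<lambda>j. a * x j) \<le> M * \<phi> x"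
    using scale by blast
  have le: "\<phi> (\<lambda>j. c * X k j) \<le> M * \<phi> (\<lambda>j. X k j / of_real \<rho>)" for k
    using M[of "c * of_real \<rho>" "\<lambda>j. X k j / of_real \<rho>"] \<rho>(1) by simp
  show ?thesis
    by (rule summable_comparison_test'[OF summable_mult[OF \<rho>(2), of M]])
      (use le nonneg in auto)
qed

lemma summable_phi: "X \<in> E \<Longrightarrow> summable (\<lambda>k. \<phi> (X k))"
  using summable_scale[of X 1] by simp

lemma E_cmult: "X \<in> E \<Longrightarrow> (\<lambda>k j. c * X k j) \<in> E"
  by (rule E_I) (auto simp: supp_in_def E_eq_0 intro: summable_scale)

text \<open>Bounds the quasinorm linearly by the modular sum: shrinking by \<rho> \<ge> 1 divides
  the sum by \<rho> at the price of \<open>C\<close>.\<close>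

lemma luxemburg_bound_max:
  assumes "X \<in> E"
  shows "luxemburg_bound \<phi> X (max 1 (C * (\<Sum>k. \<phi> (X k))))"
proof -
  define \<rho> where "\<rho> = max 1 (C * (\<Sum>k. \<phi> (X k)))"
  have \<rho>: "1 \<le> \<rho>" "C * (\<Sum>k. \<phi> (X k)) \<le> \<rho>" by (auto simp: \<rho>_def)
  have le: "\<phi> (\<lambda>j. X k j / of_real \<rho>) \<le> C / \<rho> * \<phi> (X k)" for k
    using shrink[OF \<rho>(1), of "X k"] by simp
  have sm: "summable (\<lambda>k. C / \<rho> * \<phi> (X k))"
    by (intro summable_mult summable_phi assms)
  then have s: "summable (\<lambda>k. \<phi> (\<lambda>j. X k j / of_real \<rho>))"
    by (rule summable_comparison_test') (use le nonneg in auto)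
  have "(\<Sum>k. \<phi> (\<lambda>j. X k j / of_real \<rho>)) \<le> (\<Sum>k. C / \<rho> * \<phi> (X k))"
    by (intro suminf_le le s sm)
  also have "\<dots> = C / \<rho> * (\<Sum>k. \<phi> (X k))"
    by (intro suminf_mult summable_phi assms)
  also have "\<dots> \<le> 1" using \<rho> by (simp add: field_simps)
  finally show ?thesis using s \<rho>(1) by (simp add: luxemburg_bound_def flip: \<rho>_def)
qed

lemma luxemburg_nonneg: "X \<in> E \<Longrightarrow> 0 \<le> luxemburg \<phi> X"
  by (rule le_luxemburg[OF luxemburg_bound_max]) (auto simp: luxemburg_bound_def)

text \<open>A pointwise factor \<open>b\<close> is removed by shrinking with \<open>b * C\<close>,
  since \<open>shrink\<close> then gains the factor \<open>1 / b\<close>.\<close>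

lemma luxemburg_le_mult:
  assumes le: "\<And>k \<rho>. 0 < \<rho> \<Longrightarrow> \<phi> (\<lambda>j. X k j / of_real \<rho>) \<le> b * \<psi> (\<lambda>j. Z k j / of_real \<rho>)"
    and b: "1 \<le> b" and Z: "luxemburg_bound \<psi> Z \<rho>0"
  shows "luxemburg \<phi> X \<le> (b * C) * luxemburg \<psi> Z"
proof (rule le_mult_luxemburg[OF Z])
  have "1 * 1 \<le> b * C" using b C by (intro mult_mono) auto
  then have bC: "1 \<le> b * C" by simp
  then show "0 \<le> b * C" by simp
  fix \<rho> assume "luxemburg_bound \<psi> Z \<rho>"
  then have \<rho>: "0 < \<rho>" and s: "summable (\<lambda>k. \<psi> (\<lambda>j. Z k j / of_real \<rho>))"
    and s1: "(\<Sum>k. \<psi> (\<lambda>j. Z k j / of_real \<rho>)) \<le> 1" by (auto simp: luxemburg_bound_def)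
  have le': "\<phi> (\<lambda>j. X k j / of_real (b * C * \<rho>)) \<le> \<psi> (\<lambda>j. Z k j / of_real \<rho>)" for k
  proof -
    have "\<phi> (\<lambda>j. X k j / of_real \<rho> / of_real (b * C)) \<le> C * \<phi> (\<lambda>j. X k j / of_real \<rho>) / (b * C)"
      by (rule shrink[OF bC])
    also have "\<dots> \<le> C * (b * \<psi> (\<lambda>j. Z k j / of_real \<rho>)) / (b * C)"
      using le[OF \<rho>, of k] b C by (intro divide_right_mono mult_left_mono) auto
    also have "\<dots> = \<psi> (\<lambda>j. Z k j / of_real \<rho>)" using b C by simp
    finally show ?thesis by (simp add: mult.commute mult.left_commute)
  qed
  have s': "summable (\<lambda>k. \<phi> (\<lambda>j. X k j / of_real (b * C * \<rho>)))"
    by (rule summable_comparison_test'[OF s]) (use le' nonneg in auto)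
  have "(\<Sum>k. \<phi> (\<lambda>j. X k j / of_real (b * C * \<rho>))) \<le> 1"
    using suminf_le[OF le' s' s] s1 by linarith
  then show "luxemburg \<phi> X \<le> b * C * \<rho>"
    using \<rho> bC s' by (intro luxemburg_le) (auto simp: luxemburg_bound_def intro!: mult_pos_pos)
qed

lemma tail_part_E:
  assumes "X \<in> E"
  shows "tail_part N X \<in> E"
proof (rule E_I)
  show "supp_in {..<n} (tail_part N X k)" for k
    using assms by (simp add: supp_in_def tail_part_def E_eq_0)
  show "summable (\<lambda>k. \<phi> (tail_part N X k))"
    by (rule summable_comparison_test'[OF summable_phi[OF assms]])
      (simp add: tail_part_eq zero nonneg)
qed

text \<open>By \<open>summable_scale\<close> the modular sum of X/e converges, so its tails fall
  below 1. Consequently the sequences with finitely many nonzero terms are dense.\<close>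

lemma luxemburg_tail:
  assumes X: "X \<in> E" and e: "0 < e"
  shows "\<exists>N0. \<forall>N\<ge>N0. luxemburg \<phi> (tail_part N X) \<le> e"
proof -
  define f where "f k = \<phi> (\<lambda>j. X k j / of_real e)" for k
  have f: "summable f"
    using summable_scale[OF X, of "1 / of_real e"] by (simp add: f_def[abs_def])
  obtain N0 where N0: "\<And>N. N \<ge> N0 \<Longrightarrow> norm (\<Sum>i. f (i + N)) < 1"
    using suminf_exist_split[OF zero_less_one f] by blast
  have "luxemburg \<phi> (tail_part N X) \<le> e" if N: "N \<ge> N0" for N
  proof (rule luxemburg_le)
    define g where "g k = \<phi> (\<lambda>j. tail_part N X k j / of_real e)" for k
    have g: "g k = (if k < N then 0 else f k)" for k
      by (simp add: g_def f_def tail_part_def zero)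
    have fn: "0 \<le> f k" for k by (simp add: f_def nonneg)
    have gs: "summable g"
      by (rule summable_comparison_test'[OF f]) (auto simp: g fn)
    have "(\<Sum>k. g k) = (\<Sum>k. g (k + N)) + (\<Sum>k<N. g k)"
      by (rule suminf_split_initial_segment[OF gs])
    also have "\<dots> = (\<Sum>k. f (k + N))" by (simp add: g)
    finally have "(\<Sum>k. g k) = (\<Sum>k. f (k + N))" .
    then have "(\<Sum>k. g k) \<le> 1" using N0[OF N] by simp
    then show "luxemburg_bound \<phi> (tail_part N X) e"
      using gs e by (simp add: luxemburg_bound_def g_def[abs_def])
  qed
  then show ?thesis by blast
qed

lemma finite_support_E:
  assumes "\<And>k. supp_in {..<n} (X k)" "finite {k. X k \<noteq> (\<lambda>_. 0)}"
  shows "X \<in> E"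
  using assms(1) by (rule E_I) (auto intro!: summable_finite[OF assms(2)] simp: zero)

end

section \<open>Coordinate functionals and defects of a bounded operator\<close>

locale bounded_C01_operator = quasi_young +
  fixes T :: "vseq \<Rightarrow> real \<Rightarrow> complex" and K :: real
  assumes T_cont: "X \<in> E \<Longrightarrow> continuous_on {0..1} (T X)"
    and T_add: "X \<in> E \<Longrightarrow> Z \<in> E \<Longrightarrow> t \<in> {0..1} \<Longrightarrow> T (\<lambda>k j. X k j + Z k j) t = T X t + T Z t"
    and T_cmult: "X \<in> E \<Longrightarrow> t \<in> {0..1} \<Longrightarrow> T (\<lambda>k j. c * X k j) t = c * T X t"
    and K: "0 \<le> K"
    and T_le: "X \<in> E \<Longrightarrow> t \<in> {0..1} \<Longrightarrow> cmod (T X t) \<le> K * luxemburg \<phi> X"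
begin

definition unit_at :: "nat \<Rightarrow> nat \<Rightarrow> vseq" where
  "unit_at k j = (\<lambda>k' j'. if k' = k \<and> j' = j then 1 else 0)"

definition Y :: "nat \<Rightarrow> nat \<Rightarrow> real \<Rightarrow> complex" where
  "Y k j t = T (unit_at k j) t"

definition finite_E :: "vseq \<Rightarrow> bool" where
  "finite_E X \<longleftrightarrow> (\<forall>k. supp_in {..<n} (X k)) \<and> finite {k. X k \<noteq> (\<lambda>_. 0)}"

lemma finite_E_imp_E: "finite_E X \<Longrightarrow> X \<in> E"
  using finite_support_E by (auto simp: finite_E_def)

lemma finite_E_unit: "j < n \<Longrightarrow> finite_E (\<lambda>k' j'. c * unit_at k j k' j')"
  unfolding finite_E_def
proof safe
  show "finite {k'. (\<lambda>j'. c * unit_at k j k' j') \<noteq> (\<lambda>_. 0)}"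
    by (rule finite_subset[of _ "{k}"]) (auto simp: unit_at_def)
qed (simp add: supp_in_def unit_at_def)

lemma unit_at_E: "j < n \<Longrightarrow> unit_at k j \<in> E"
  using finite_E_imp_E[OF finite_E_unit[of j 1 k]] by simp

text \<open>Additivity of \<open>T\<close> is given on \<open>E\<close> only, so membership of the
  partial sums is carried through the induction.\<close>

lemma T_sum:
  assumes "finite I" "\<And>i. i \<in> I \<Longrightarrow> finite_E (X i)" "t \<in> {0..1}"
  shows "finite_E (\<lambda>k j. \<Sum>i\<in>I. X i k j) \<and> T (\<lambda>k j. \<Sum>i\<in>I. X i k j) t = (\<Sum>i\<in>I. T (X i) t)"
  using assms
proof (induction I)
  case empty
  have 0: "finite_E (\<lambda>k j. 0)" by (simp add: finite_E_def supp_in_def)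
  then show ?case using T_cmult[OF finite_E_imp_E[OF 0], of t 0] empty by simp
next
  case (insert i I)
  have 1: "finite_E (X i)" and 2: "finite_E (\<lambda>k j. \<Sum>i\<in>I. X i k j)" 
    and 3: "T (\<lambda>k j. \<Sum>i\<in>I. X i k j) t = (\<Sum>i\<in>I. T (X i) t)"
    using insert by auto
  have "finite_E (\<lambda>k j. X i k j + (\<Sum>i\<in>I. X i k j))"
  proof -
    have "{k. (\<lambda>j. X i k j + (\<Sum>i\<in>I. X i k j)) \<noteq> (\<lambda>_. 0)}
        \<subseteq> {k. X i k \<noteq> (\<lambda>_. 0)} \<union> {k. (\<lambda>j. \<Sum>i\<in>I. X i k j) \<noteq> (\<lambda>_. 0)}"
      by (auto simp: fun_eq_iff)
    then have "finite {k. (\<lambda>j. X i k j + (\<Sum>i\<in>I. X i k j)) \<noteq> (\<lambda>_. 0)}"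
      using 1 2 unfolding finite_E_def by (blast intro: finite_subset)
    then show ?thesis using 1 2 by (simp add: finite_E_def supp_in_def)
  qed
  moreover have "T (\<lambda>k j. X i k j + (\<Sum>i\<in>I. X i k j)) t = T (X i) t + (\<Sum>i\<in>I. T (X i) t)"
    using T_add[OF finite_E_imp_E[OF 1] finite_E_imp_E[OF 2] insert.prems(2)] 3 by simp
  ultimately show ?case using insert.hyps by simp
qed

lemma T_head_part:
  assumes "\<And>k. supp_in {..<n} (v k)" "t \<in> {0..1}"
  shows "head_part N v \<in> E"
    and "T (head_part N v) t = (\<Sum>k<N. pairing {..<n} (\<lambda>j. Y k j t) (v k))"
proof -
  let ?I = "{..<N} \<times> {..<n}"
  define X where "X i = (\<lambda>k j. v (fst i) (snd i) * unit_at (fst i) (snd i) k j)" for i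
  have fin: "finite_E (X i)" if "i \<in> ?I" for i
    unfolding X_def using that by (intro finite_E_unit) auto
  have "(\<Sum>i\<in>?I. X i k j) = head_part N v k j" for k j
  proof -
    have "(\<Sum>i\<in>?I. X i k j) = (\<Sum>i\<in>?I. if i = (k, j) then v k j else 0)"
      by (intro sum.cong) (auto simp: X_def unit_at_def)
    also have "\<dots> = head_part N v k j"
      using assms(1)[of k] by (auto simp: head_part_def supp_in_def)
    finally show ?thesis .
  qed
  then have eq: "(\<lambda>k j. \<Sum>i\<in>?I. X i k j) = head_part N v" by blast
  have T: "finite_E (head_part N v) \<and> T (head_part N v) t = (\<Sum>i\<in>?I. T (X i) t)"
    using T_sum[of ?I X t, unfolded eq] fin assms(2) by simp
  then show "head_part N v \<in> E" by (simp add: finite_E_imp_E)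
  have "(\<Sum>i\<in>?I. T (X i) t) = (\<Sum>i\<in>?I. v (fst i) (snd i) * Y (fst i) (snd i) t)"
    using assms(2) by (intro sum.cong) (auto simp: X_def Y_def T_cmult unit_at_E)
  also have "\<dots> = (\<Sum>k<N. pairing {..<n} (\<lambda>j. Y k j t) (v k))"
    by (simp add: pairing_def sum.cartesian_product mult.commute case_prod_unfold)
  finally show "T (head_part N v) t = (\<Sum>k<N. pairing {..<n} (\<lambda>j. Y k j t) (v k))"
    using T by simp
qed

text \<open>Boundedness of \<open>T\<close> in dual form: \<open>T\<close> is tested on the finite
  sequence of the \<open>v k\<close>, whose quasinorm is at most 1 plus \<open>C\<close> times the
  sum of the \<open>\<phi> (v k)\<close>. The bound is uniform in \<open>N\<close>, \<open>t\<close>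
  and \<open>v\<close>.\<close>

lemma sum_pairing_le:
  assumes "\<And>k. supp_in {..<n} (v k)" "t \<in> {0..1}"
  shows "(\<Sum>k<N. Re (pairing {..<n} (\<lambda>j. Y k j t) (v k)) - C * K * \<phi> (v k)) \<le> K"
proof -
  define X where "X = head_part N v"
  have X: "X \<in> E" unfolding X_def by (rule T_head_part[OF assms])
  have "(\<Sum>k. \<phi> (X k)) = (\<Sum>k<N. \<phi> (X k))"
    by (intro suminf_finite) (auto simp: X_def head_part_def zero)
  also have "\<dots> = (\<Sum>k<N. \<phi> (v k))" by (simp add: X_def head_part_def)
  finally have s: "(\<Sum>k. \<phi> (X k)) = (\<Sum>k<N. \<phi> (v k))" .
  have "(\<Sum>k<N. Re (pairing {..<n} (\<lambda>j. Y k j t) (v k))) = Re (T X t)"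
    unfolding X_def T_head_part(2)[OF assms] by simp
  also have "\<dots> \<le> cmod (T X t)" by (rule complex_Re_le_cmod)
  also have "\<dots> \<le> K * luxemburg \<phi> X" by (rule T_le[OF X assms(2)])
  also have "\<dots> \<le> K * max 1 (C * (\<Sum>k. \<phi> (X k)))"
    by (intro mult_left_mono luxemburg_le luxemburg_bound_max X K)
  also have "\<dots> \<le> K * (1 + C * (\<Sum>k<N. \<phi> (v k)))"
  proof -
    have "0 \<le> C * (\<Sum>k<N. \<phi> (v k))"
      using C nonneg by (intro mult_nonneg_nonneg sum_nonneg) auto
    then show ?thesis unfolding s using K by (intro mult_left_mono) auto
  qed
  finally show ?thesis by (simp add: sum_subtractf sum_distrib_left algebra_simps)
qed

text \<open>The Fenchel conjugate of \<open>C * K * \<phi>\<close> at the real part of the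
  functional with coefficients \<open>Y k j t\<close>; the factor \<open>C * K\<close> is the one in
  \<open>sum_pairing_le\<close>.\<close>

definition q :: "nat \<Rightarrow> real \<Rightarrow> real" where
  "q k t = (SUP v\<in>{v. supp_in {..<n} v}. Re (pairing {..<n} (\<lambda>j. Y k j t) v) - C * K * \<phi> v)"

lemma q_upper:
  assumes t: "t \<in> {0..1}" and v: "supp_in {..<n} v"
  shows "Re (pairing {..<n} (\<lambda>j. Y k j t) v) - C * K * \<phi> v \<le> q k t"
  unfolding q_def
proof (rule cSUP_upper)
  have "Re (pairing {..<n} (\<lambda>j. Y k j t) v) - C * K * \<phi> v \<le> K" if v: "supp_in {..<n} v" for v
  proof -
    \<comment> \<open>All vectors but the k-th are zero, so the summed estimate bounds a single
      defect and the supremum is finite.\<close>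
    have "(\<Sum>k'<Suc k. Re (pairing {..<n} (\<lambda>j. Y k' j t) (if k' = k then v else (\<lambda>_. 0))) -
        C * K * \<phi> (if k' = k then v else (\<lambda>_. 0))) \<le> K"
      using v by (intro sum_pairing_le t) (auto simp: supp_in_def)
    then show ?thesis by (simp add: pairing_def zero)
  qed
  then show "bdd_above ((\<lambda>v. Re (pairing {..<n} (\<lambda>j. Y k j t) v) - C * K * \<phi> v) ` {v. supp_in {..<n} v})"
    by (auto simp: bdd_above_def)
qed (use v in auto)

lemma q_nonneg: "t \<in> {0..1} \<Longrightarrow> 0 \<le> q k t"
  using q_upper[of t "\<lambda>_. 0" k] by (simp add: supp_in_def pairing_def zero)

text \<open>The suprema for different \<open>k\<close> involve independent vectors, so
  near-maximisers can be inserted together into \<open>sum_pairing_le\<close>.\<close>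

lemma q_sum_le:
  assumes t: "t \<in> {0..1}"
  shows "(\<Sum>k<N. q k t) \<le> K"
proof (rule field_le_epsilon)
  fix e :: real assume e: "0 < e"
  define d where "d = e / (real N + 1)"
  have d: "0 < d" "real N * d \<le> e" using e by (auto simp: d_def field_simps)
  have "\<exists>v. supp_in {..<n} v \<and> q k t - d < Re (pairing {..<n} (\<lambda>j. Y k j t) v) - C * K * \<phi> v" for k
  proof (rule ccontr)
    assume "\<not> ?thesis"
    then have "q k t \<le> q k t - d" unfolding q_def
      by (intro cSUP_least) (auto simp: q_def supp_in_def not_less intro!: exI[of _ "\<lambda>_. 0"])
    then show False using d by simp
  qed
  then obtain v where v: "\<And>k. supp_in {..<n} (v k)"
    "\<And>k. q k t - d < Re (pairing {..<n} (\<lambda>j. Y k j t) (v k)) - C * K * \<phi> (v k)" by metis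
  have "(\<Sum>k<N. q k t - d) \<le> (\<Sum>k<N. Re (pairing {..<n} (\<lambda>j. Y k j t) (v k)) - C * K * \<phi> (v k))"
    using v(2) by (intro sum_mono less_imp_le)
  also have "\<dots> \<le> K" by (rule sum_pairing_le[OF v(1) t])
  finally show "(\<Sum>k<N. q k t) \<le> K + e" using d by (simp add: sum_subtractf)
qed

lemma q_summable: "t \<in> {0..1} \<Longrightarrow> summable (\<lambda>k. q k t)"
  and q_suminf_le: "t \<in> {0..1} \<Longrightarrow> (\<Sum>k. q k t) \<le> K"
proof -
  assume t: "t \<in> {0..1}"
  show s: "summable (\<lambda>k. q k t)"
    by (rule summableI_nonneg_bounded[where x = K]) (use q_nonneg[OF t] q_sum_le[OF t] in auto)
  show "(\<Sum>k. q k t) \<le> K"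
    by (rule suminf_le_const[OF s q_sum_le[OF t]])
qed

text \<open>The tail of \<open>X\<close> contributes at most \<open>K\<close> times its quasinorm,
  which tends to 0 by \<open>luxemburg_tail\<close>; hence the coefficients \<open>Y\<close>
  determine \<open>T\<close>.\<close>

lemma T_sums:
  assumes X: "X \<in> E" and t: "t \<in> {0..1}"
  shows "(\<lambda>k. pairing {..<n} (\<lambda>j. Y k j t) (X k)) sums T X t"
  unfolding sums_def
proof (rule LIMSEQ_I)
  fix e :: real assume e: "0 < e"
  obtain N0 where N0: "\<And>N. N \<ge> N0 \<Longrightarrow> luxemburg \<phi> (tail_part N X) \<le> e / (K + 1)"
    using luxemburg_tail[OF X, of "e / (K + 1)"] e K by auto
  have "cmod ((\<Sum>k<N. pairing {..<n} (\<lambda>j. Y k j t) (X k)) - T X t) < e" if "N \<ge> N0" for N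
  proof -
    have "X = (\<lambda>k j. head_part N X k j + tail_part N X k j)"
      by (auto simp: head_part_def tail_part_def fun_eq_iff)
    then have "T X t = T (head_part N X) t + T (tail_part N X) t"
      using T_add[OF T_head_part(1)[of X t N] tail_part_E[OF X, of N] t] E_supp[OF X] t by simp
    then have "cmod ((\<Sum>k<N. pairing {..<n} (\<lambda>j. Y k j t) (X k)) - T X t) = cmod (T (tail_part N X) t)"
      using T_head_part(2)[of X t N] E_supp[OF X] t by simp
    also have "\<dots> \<le> K * luxemburg \<phi> (tail_part N X)" by (rule T_le[OF tail_part_E[OF X] t])
    also have "\<dots> \<le> K * (e / (K + 1))" by (intro mult_left_mono N0 that K)
    also have "\<dots> < e" using e K by (simp add: field_simps)
    finally show ?thesis .
  qed
  then show "\<exists>N0. \<forall>N\<ge>N0. norm ((\<Sum>k<N. pairing {..<n} (\<lambda>j. Y k j t) (X k)) - T X t) < e" by auto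
qed

end

section \<open>The extension theorem\<close>

definition shift_up :: "nat \<Rightarrow> nat \<Rightarrow> (nat \<Rightarrow> complex) \<Rightarrow> nat \<Rightarrow> complex" where
  "shift_up l m x = (\<lambda>j. if l \<le> j \<and> j < m then x (j - l) else 0)"

lemma tuple_embed_eq: "tuple_embed n m X k = shift_up (m - n) m (X k)"
  by (simp add: tuple_embed_def shift_up_def)

text \<open>The rotation u = cnj z / |z| turns \<open>z\<close> into its modulus.\<close>

lemma cmod_le_if_Re_le:
  assumes "\<And>u. cmod u = 1 \<Longrightarrow> Re (u * z) \<le> B" 
  shows "cmod z \<le> B"
proof (cases "z = 0")
  case True
  then show ?thesis using assms[of 1] by simp
next
  case False
  define u where "u = cnj z / of_real (cmod z)"
  have "cmod u = 1" using False by (simp add: u_def norm_divide)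
  moreover have "u * z = of_real (cmod z)"
    using False by (simp add: u_def mult.commute complex_norm_square[symmetric] power2_eq_square)
  ultimately show ?thesis using assms[of u] by simp
qed

lemma pairing_shift:
  assumes "n \<le> m"
  shows "pairing {m - n..<m} (\<lambda>j. y (j - (m - n))) (shift_up (m - n) m x) = pairing {..<n} y x"
proof -
  have "(\<Sum>j\<in>{0 + (m - n)..<n + (m - n)}. y (j - (m - n)) * shift_up (m - n) m x j)
      = (\<Sum>j\<in>{0..<n}. y j * shift_up (m - n) m x (j + (m - n)))"
    by (subst sum.shift_bounds_nat_ivl) simp
  also have "\<dots> = (\<Sum>j\<in>{0..<n}. y j * x j)"
    using assms by (intro sum.cong) (auto simp: shift_up_def)
  finally show ?thesis using assms by (simp add: pairing_def lessThan_atLeast0)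
qed

lemma pairing_support:
  assumes "J \<subseteq> I" "finite I" "supp_in J x"
  shows "pairing I \<xi> x = pairing J \<xi> x"
  unfolding pairing_def using assms by (intro sum.mono_neutral_right) (auto simp: supp_in_def)

lemma supp_in_shift_up: "supp_in {l..<m} (shift_up l m x)"
  by (auto simp: supp_in_def shift_up_def)

context bounded_C01_operator
begin

text \<open>The extended operator sums the extended functionals. Each term is dominated by a
  multiple of \<open>\<psi> (X k)\<close>, a defect and a geometric error, all summable in
  \<open>k\<close>.\<close>

lemma extension_exists:
  assumes \<psi>: "quasi_young m \<psi> C'" and nm: "n \<le> m"
    and b: "1 \<le> b" "\<And>x. \<phi> x \<le> b * \<psi> (shift_up (m - n) m x)"
  shows "\<exists>S. bounded_operator_C01 (fenchel_orlicz m \<psi>) (luxemburg \<psi>) S \<and>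
    (\<forall>y\<in>E. \<forall>t\<in>{0..1}. S (tuple_embed n m y) t = T y t)"
proof -
  interpret \<psi>: quasi_young m \<psi> C' by (rule \<psi>)
  define l where "l = m - n"
  \<comment> \<open>The defect inequality for \<open>C * K * \<phi>\<close> becomes one for
    \<open>\<psi>\<close> on the embedded copy of the small space, at the cost of
    \<open>b\<close>.\<close>
  define \<kappa> where "\<kappa> = C * K * b"
  define K1 where "K1 = C' ^ (2 * l) * \<kappa> + 1"
  have \<kappa>: "0 \<le> \<kappa>" using C K b by (simp add: \<kappa>_def)
  have K1: "0 \<le> K1" using \<psi>.C \<kappa> by (simp add: K1_def)
  have "\<exists>\<xi>. (\<forall>j<m. continuous_on {0..1} (\<xi> j)) \<and> (\<forall>j\<in>{l..<m}. \<forall>t\<in>{0..1}. \<xi> j t = Y k (j - l) t) \<and>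
    (\<forall>t\<in>{0..1}. \<forall>x. supp_in {..<m} x \<longrightarrow>
      Re (pairing {..<m} (\<lambda>j. \<xi> j t) x) \<le> K1 * \<psi> x + q k t + (1 / 2) ^ k)" for k
    unfolding K1_def
  proof (rule \<psi>.continuous_extension)
    show "l \<le> m" by (simp add: l_def)
    show "0 \<le> \<kappa>" by (rule \<kappa>)
    show "continuous_on {0..1} (Y k (j - l))" if "j \<in> {l..<m}" for j
      using that nm unfolding Y_def by (intro T_cont unit_at_E) (auto simp: l_def)
    show "0 \<le> q k t" if "t \<in> {0..1}" for t using that by (rule q_nonneg)
    show "Re (pairing {l..<m} (\<lambda>j. Y k (j - l) t) x) \<le> \<kappa> * \<psi> x + q k t"
      if t: "t \<in> {0..1}" and x: "supp_in {l..<m} x" for t x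
    proof -
      define v where "v = (\<lambda>j. if j < n then x (j + l) else 0)"
      have xv: "x = shift_up l m v"
        using x nm by (auto simp: fun_eq_iff shift_up_def v_def l_def supp_in_def)
      have "supp_in {..<n} v" by (simp add: v_def supp_in_def)
      then have "Re (pairing {..<n} (\<lambda>j. Y k j t) v) \<le> C * K * \<phi> v + q k t"
        using q_upper[OF t] by (simp add: algebra_simps)
      also have "C * K * \<phi> v \<le> C * K * (b * \<psi> x)"
        unfolding xv l_def using C K by (intro mult_left_mono b(2)) auto
      also have "\<dots> = \<kappa> * \<psi> x" by (simp add: \<kappa>_def)
      also have "pairing {..<n} (\<lambda>j. Y k j t) v = pairing {l..<m} (\<lambda>j. Y k (j - l) t) x"
        unfolding xv l_def by (rule pairing_shift[OF nm, symmetric])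
      finally show ?thesis by simp
    qed
  qed simp
  then obtain \<xi> where \<xi>_cont: "\<And>k j. j < m \<Longrightarrow> continuous_on {0..1} (\<xi> k j)"
    and \<xi>_Y: "\<And>k j t. j \<in> {l..<m} \<Longrightarrow> t \<in> {0..1} \<Longrightarrow> \<xi> k j t = Y k (j - l) t"
    and \<xi>_le: "\<And>k t x. t \<in> {0..1} \<Longrightarrow> supp_in {..<m} x \<Longrightarrow>
      Re (pairing {..<m} (\<lambda>j. \<xi> k j t) x) \<le> K1 * \<psi> x + q k t + (1 / 2) ^ k"
    by metis
  \<comment> \<open>Only real parts are bounded so far; \<open>M\<close> pays for the rotations that
    turn this into a bound on the modulus.\<close>
  obtain M where M: "0 \<le> M" "\<And>c x. cmod c \<le> 1 \<Longrightarrow> \<psi> (\<lambda>j. c * x j) \<le> M * \<psi> x"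
    using \<psi>.scale by blast
  define K2 where "K2 = K1 * M"
  have K2: "0 \<le> K2" using K1 M by (simp add: K2_def)
  define a where "a X k t = pairing {..<m} (\<lambda>j. \<xi> k j t) (X k)" for X :: vseq and k t
  define bnd where "bnd X k t = K2 * \<psi> (X k) + q k t + (1 / 2) ^ k" for X :: vseq and k t
  have a_le: "cmod (a X k t) \<le> bnd X k t" if X: "X \<in> \<psi>.E" and t: "t \<in> {0..1}" for X k t
  proof (rule cmod_le_if_Re_le)
    fix u :: complex assume u: "cmod u = 1"
    have "supp_in {..<m} (\<lambda>j. u * X k j)"
      using \<psi>.E_supp[OF X, of k] by (simp add: supp_in_def)
    then have "Re (u * a X k t) \<le> K1 * \<psi> (\<lambda>j. u * X k j) + q k t + (1 / 2) ^ k"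
      using \<xi>_le[OF t] by (simp add: a_def pairing_cmult[symmetric] del: times_complex.sel)
    also have "K1 * \<psi> (\<lambda>j. u * X k j) \<le> K1 * (M * \<psi> (X k))"
      using K1 u by (intro mult_left_mono M) auto
    finally show "Re (u * a X k t) \<le> bnd X k t" by (simp add: bnd_def K2_def mult.assoc)
  qed
  have bnd_summable: "summable (\<lambda>k. bnd X k t)"
    and bnd_le: "(\<Sum>k. bnd X k t) \<le> K2 * (\<Sum>k. \<psi> (X k)) + K + 2"
    if X: "X \<in> \<psi>.E" and t: "t \<in> {0..1}" for X t
  proof -
    have s1: "summable (\<lambda>k. K2 * \<psi> (X k))" by (intro summable_mult \<psi>.summable_phi X)
    have s2: "summable (\<lambda>k. (1 / 2 :: real) ^ k)" by (intro summable_geometric) simp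
    show "summable (\<lambda>k. bnd X k t)"
      unfolding bnd_def by (intro summable_add s1 s2 q_summable t)
    have "(\<Sum>k. bnd X k t) = (\<Sum>k. K2 * \<psi> (X k)) + (\<Sum>k. q k t) + (\<Sum>k. (1 / 2) ^ k)"
      unfolding bnd_def
      by (simp only: suminf_add[OF s1 q_summable[OF t]]
          suminf_add[OF summable_add[OF s1 q_summable[OF t]] s2])
    also have "(\<Sum>k. K2 * \<psi> (X k)) = K2 * (\<Sum>k. \<psi> (X k))" by (intro suminf_mult \<psi>.summable_phi X)
    also have "(\<Sum>k. (1 / 2 :: real) ^ k) = 2" by (subst suminf_geometric) auto
    finally show "(\<Sum>k. bnd X k t) \<le> K2 * (\<Sum>k. \<psi> (X k)) + K + 2" using q_suminf_le[OF t] by simp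
  qed
  have a_summable: "summable (\<lambda>k. a X k t)" if "X \<in> \<psi>.E" "t \<in> {0..1}" for X t
    by (rule summable_comparison_test'[OF bnd_summable[OF that]]) (use a_le[OF that] in auto)
  have a_suminf: "cmod (\<Sum>k. a X k t) \<le> K2 * (\<Sum>k. \<psi> (X k)) + K + 2"
    if "X \<in> \<psi>.E" "t \<in> {0..1}" for X t
    using norm_suminf_le[OF a_le[OF that] bnd_summable[OF that]] bnd_le[OF that] by linarith
  have a_cmult: "a (\<lambda>k j. c * X k j) k t = c * a X k t" for c X k t
    by (simp add: a_def pairing_cmult)
  have a_add: "a (\<lambda>k j. X k j + Z k j) k t = a X k t + a Z k t" for X Z k t
    by (simp add: a_def pairing_add)
  define S where "S X t = (\<Sum>k. a X k t)" for X t
  have S_cont: "continuous_on {0..1} (S X)" if X: "X \<in> \<psi>.E" for X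
  proof -
    have "uniform_limit {0..1} (\<lambda>N t. \<Sum>k<N. a X k t) (S X) sequentially"
    proof (rule uniform_limitI)
      fix e :: real assume e: "0 < e"
      \<comment> \<open>The bound in \<open>a_suminf\<close> does not become small with the tail,
        and tails of \<open>q k t\<close> are not controlled uniformly in \<open>t\<close>. Instead
        it is applied to the tail of \<open>R\<close> times \<open>X\<close>, whose modular sum is
        at most 1 from some \<open>N0\<close> on that depends on \<open>X\<close> and
        \<open>e\<close> but not on \<open>t\<close>; dividing by \<open>R\<close> gives an error
        below \<open>e\<close>.\<close>
      define R where "R = (K2 + K + 3) / e"
      have R: "0 < R" using e K2 K by (simp add: R_def)
      define Z where "Z = (\<lambda>k j. of_real R * X k j)"
      have Z: "Z \<in> \<psi>.E" unfolding Z_def by (rule \<psi>.E_cmult[OF X])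
      obtain N0 where N0: "\<And>N. N \<ge> N0 \<Longrightarrow> norm (\<Sum>i. \<psi> (Z (i + N))) < 1"
        using suminf_exist_split[OF zero_less_one \<psi>.summable_phi[OF Z]] by blast
      have "dist (\<Sum>k<N. a X k t) (S X t) < e" if N: "N \<ge> N0" and t: "t \<in> {0..1}" for N t
      proof -
        have tZ: "tail_part N Z \<in> \<psi>.E" by (rule \<psi>.tail_part_E[OF Z])
        have tX: "tail_part N X \<in> \<psi>.E" by (rule \<psi>.tail_part_E[OF X])
        have "(\<Sum>k. \<psi> (tail_part N Z k)) = (\<Sum>k. \<psi> (tail_part N Z (k + N))) + (\<Sum>k<N. \<psi> (tail_part N Z k))"
          by (rule suminf_split_initial_segment[OF \<psi>.summable_phi[OF tZ]])
        also have "\<dots> = (\<Sum>k. \<psi> (Z (k + N)))" by (simp add: tail_part_eq \<psi>.zero)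
        finally have small: "(\<Sum>k. \<psi> (tail_part N Z k)) \<le> 1" using N0[OF N] by simp
        have "S X t = (\<Sum>k. a X (k + N) t) + (\<Sum>k<N. a X k t)"
          unfolding S_def by (rule suminf_split_initial_segment[OF a_summable[OF X t]])
        moreover have "(\<Sum>k. a (tail_part N X) k t) =
            (\<Sum>k. a (tail_part N X) (k + N) t) + (\<Sum>k<N. a (tail_part N X) k t)"
          by (rule suminf_split_initial_segment[OF a_summable[OF tX t]])
        moreover have "a (tail_part N X) k t = (if k < N then 0 else a X k t)" for k
          by (simp add: a_def tail_part_eq pairing_def)
        ultimately have "S X t - (\<Sum>k<N. a X k t) = (\<Sum>k. a (tail_part N X) k t)" by simp
        moreover have "a (tail_part N Z) k t = of_real R * a (tail_part N X) k t" for k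
          by (simp add: a_def tail_part_eq pairing_def Z_def sum_distrib_left algebra_simps)
        then have "(\<Sum>k. a (tail_part N Z) k t) = of_real R * (\<Sum>k. a (tail_part N X) k t)"
          by (simp add: suminf_mult[OF a_summable[OF tX t]])
        ultimately have "R * cmod (S X t - (\<Sum>k<N. a X k t)) = cmod (\<Sum>k. a (tail_part N Z) k t)"
          using R by (simp add: norm_mult)
        also have "\<dots> \<le> K2 * (\<Sum>k. \<psi> (tail_part N Z k)) + K + 2" by (rule a_suminf[OF tZ t])
        also have "\<dots> \<le> K2 * 1 + K + 2" using small K2 by (intro add_right_mono mult_left_mono)
        also have "\<dots> < R * e" using e by (simp add: R_def)
        finally show ?thesis using R by (simp add: dist_norm norm_minus_commute)
      qed
      then show "\<forall>\<^sub>F N in sequentially. \<forall>t\<in>{0..1}. dist (\<Sum>k<N. a X k t) (S X t) < e"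
        unfolding eventually_sequentially by blast
    qed
    moreover have "continuous_on {0..1} (\<lambda>t. \<Sum>k<N. a X k t)" for N
      unfolding a_def pairing_def by (intro continuous_intros \<xi>_cont) auto
    ultimately show ?thesis
      by (intro uniform_limit_theorem[where F = sequentially]) auto
  qed
  have S_le: "cmod (S X t) \<le> (K2 + K + 2) * luxemburg \<psi> X" if X: "X \<in> \<psi>.E" and t: "t \<in> {0..1}" for X t
  proof (rule le_mult_luxemburg[OF \<psi>.luxemburg_bound_max[OF X]])
    show "0 \<le> K2 + K + 2" using K2 K by simp
    fix \<rho> assume "luxemburg_bound \<psi> X \<rho>"
    then have \<rho>: "0 < \<rho>" and le1: "(\<Sum>k. \<psi> (\<lambda>j. X k j / of_real \<rho>)) \<le> 1"
      by (auto simp: luxemburg_bound_def)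
    \<comment> \<open>The normalised sequence has modular sum at most 1, so \<open>a_suminf\<close>
      bounds its image by a constant, and homogeneity restores the factor \<rho>.\<close>
    define Z where "Z = (\<lambda>k j. (1 / of_real \<rho>) * X k j)"
    have Z: "Z \<in> \<psi>.E" unfolding Z_def by (rule \<psi>.E_cmult[OF X])
    have "S Z t = (1 / of_real \<rho>) * S X t"
      unfolding S_def Z_def a_cmult by (rule suminf_mult[OF a_summable[OF X t]])
    then have "cmod (S X t) = \<rho> * cmod (S Z t)" using \<rho> by (simp add: norm_divide)
    also have "cmod (S Z t) \<le> K2 * (\<Sum>k. \<psi> (Z k)) + K + 2" unfolding S_def by (rule a_suminf[OF Z t])
    also have "\<dots> \<le> K2 * 1 + K + 2"
      using le1 K2 by (intro add_right_mono mult_left_mono) (auto simp: Z_def)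
    finally show "cmod (S X t) \<le> (K2 + K + 2) * \<rho>" using \<rho> by (simp add: mult.commute)
  qed
  have "bounded_operator_C01 \<psi>.E (luxemburg \<psi>) S"
    unfolding bounded_operator_C01_def
  proof (intro conjI ballI allI exI)
    fix X Z t assume X: "X \<in> \<psi>.E" and Z: "Z \<in> \<psi>.E" and t: "t \<in> {0..1::real}"
    show "S (\<lambda>k j. X k j + Z k j) t = S X t + S Z t"
      unfolding S_def a_add by (rule suminf_add[symmetric, OF a_summable[OF X t] a_summable[OF Z t]])
  next
    fix c X t assume X: "X \<in> \<psi>.E" and t: "t \<in> {0..1::real}"
    show "S (\<lambda>k j. c * X k j) t = c * S X t"
      unfolding S_def a_cmult by (rule suminf_mult[OF a_summable[OF X t]])
  next
    fix X assume X: "X \<in> \<psi>.E"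
    show "sup_norm01 (S X) \<le> (K2 + K + 2) * luxemburg \<psi> X"
      unfolding sup_norm01_def by (rule cSUP_least) (use S_le[OF X] in auto)
  qed (rule S_cont)
  moreover have "S (tuple_embed n m y) t = T y t" if y: "y \<in> E" and t: "t \<in> {0..1}" for y t
  proof -
    have "a (tuple_embed n m y) k t = pairing {..<n} (\<lambda>j. Y k j t) (y k)" for k
    proof -
      have "a (tuple_embed n m y) k t = pairing {l..<m} (\<lambda>j. \<xi> k j t) (shift_up l m (y k))"
        unfolding a_def tuple_embed_eq l_def
        by (intro pairing_support supp_in_shift_up) auto
      also have "\<dots> = pairing {l..<m} (\<lambda>j. Y k (j - l) t) (shift_up l m (y k))"
        unfolding pairing_def using t by (intro sum.cong) (auto simp: \<xi>_Y)
      also have "\<dots> = pairing {..<n} (\<lambda>j. Y k j t) (y k)"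
        unfolding l_def by (rule pairing_shift[OF nm])
      finally show ?thesis .
    qed
    then show ?thesis unfolding S_def using T_sums[OF y t] by (simp add: sums_iff)
  qed
  ultimately show ?thesis by blast
qed

end

lemma norm_le_sup_norm01:
  assumes "continuous_on {0..1} f" "t \<in> {0..1}"
  shows "cmod (f t) \<le> sup_norm01 f"
  unfolding sup_norm01_def
proof (rule cSUP_upper[OF assms(2)])
  have "compact ((\<lambda>t. cmod (f t)) ` {0..1})"
    using assms(1) by (intro compact_continuous_image continuous_intros) auto
  then show "bdd_above ((\<lambda>t. cmod (f t)) ` {0..1})"
    by (intro bounded_imp_bdd_above compact_imp_bounded)
qed

text \<open>The comparison of \<open>\<phi>\<close> with \<open>\<psi>\<close> along the shift
  serves twice: it makes the embedding an isomorphism onto its image, and it transfers the defect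
  inequality to the larger space.\<close>

lemma quasi_young_C01_extension_property:
  assumes \<phi>: "quasi_young n \<phi> C" and \<psi>: "quasi_young m \<psi> C'" and nm: "n \<le> m"
    and b: "1 \<le> b" "\<And>x. \<psi> (shift_up (m - n) m x) \<le> b * \<phi> x" "\<And>x. \<phi> x \<le> b * \<psi> (shift_up (m - n) m x)"
  shows "C01_extension_property (fenchel_orlicz n \<phi>) (luxemburg \<phi>)
    (fenchel_orlicz m \<psi>) (luxemburg \<psi>) (tuple_embed n m)"
proof -
  interpret \<phi>: quasi_young n \<phi> C by (rule \<phi>)
  interpret \<psi>: quasi_young m \<psi> C' by (rule \<psi>)
  let ?\<iota> = "tuple_embed n m"
  have scale: "(\<lambda>j. ?\<iota> y k j / of_real \<rho>) = shift_up (m - n) m (\<lambda>j. y k j / of_real \<rho>)"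
    for y :: vseq and k \<rho>
    by (auto simp: tuple_embed_eq shift_up_def fun_eq_iff)
  have emb: "?\<iota> y \<in> \<psi>.E" if y: "y \<in> \<phi>.E" for y
  proof (rule \<psi>.E_I)
    show "supp_in {..<m} (?\<iota> y k)" for k by (auto simp: tuple_embed_eq shift_up_def supp_in_def)
    show "summable (\<lambda>k. \<psi> (?\<iota> y k))"
      by (rule summable_comparison_test'[OF summable_mult[OF \<phi>.summable_phi[OF y], of b]])
        (use b(2) \<psi>.nonneg in \<open>auto simp: tuple_embed_eq\<close>)
  qed
  have upper: "luxemburg \<psi> (?\<iota> y) \<le> (b * C') * luxemburg \<phi> y" if y: "y \<in> \<phi>.E" for y
    by (rule \<psi>.luxemburg_le_mult[OF _ b(1) \<phi>.luxemburg_bound_max[OF y]]) (simp add: scale b(2))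
  have lower: "luxemburg \<phi> y \<le> (b * C) * luxemburg \<psi> (?\<iota> y)" if y: "y \<in> \<phi>.E" for y
    by (rule \<phi>.luxemburg_le_mult[OF _ b(1) \<psi>.luxemburg_bound_max[OF emb[OF y]]]) (simp add: scale b(3))
  have pos: "0 < b * C" "0 < b * C'" using b(1) \<phi>.C \<psi>.C by auto
  have "subspace_via \<phi>.E (luxemburg \<phi>) \<psi>.E (luxemburg \<psi>) ?\<iota>"
    unfolding subspace_via_def
  proof (intro conjI ballI allI)
    show "?\<iota> y \<in> \<psi>.E" if "y \<in> \<phi>.E" for y using that by (rule emb)
    show "\<exists>a>0. \<exists>c>0. \<forall>y\<in>\<phi>.E. a * luxemburg \<phi> y \<le> luxemburg \<psi> (?\<iota> y) \<and> luxemburg \<psi> (?\<iota> y) \<le> c * luxemburg \<phi> y"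
      using pos upper lower
      by (intro exI[of _ "1 / (b * C)"] exI[of _ "b * C'"] conjI ballI) (auto simp: field_simps)
  qed (auto simp: tuple_embed_def fun_eq_iff)
  moreover have "\<exists>S. bounded_operator_C01 \<psi>.E (luxemburg \<psi>) S \<and> (\<forall>y\<in>\<phi>.E. \<forall>t\<in>{0..1}. S (?\<iota> y) t = T y t)"
    if T: "bounded_operator_C01 \<phi>.E (luxemburg \<phi>) T" for T
  proof -
    have "\<exists>K. \<forall>X\<in>\<phi>.E. sup_norm01 (T X) \<le> K * luxemburg \<phi> X"
      using T by (simp add: bounded_operator_C01_def)
    then obtain K where K: "\<And>X. X \<in> \<phi>.E \<Longrightarrow> sup_norm01 (T X) \<le> K * luxemburg \<phi> X"
      by blast
    have T_cont: "continuous_on {0..1} (T X)" if "X \<in> \<phi>.E" for X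
      using T that by (simp add: bounded_operator_C01_def)
    \<comment> \<open>The constant of a bounded operator carries no sign; replacing it by
      \<open>max 0 K\<close> is harmless because the quasinorm is nonnegative.\<close>
    interpret bounded_C01_operator n \<phi> C T "max 0 K"
    proof unfold_locales
      show "cmod (T X t) \<le> max 0 K * luxemburg \<phi> X" if X: "X \<in> \<phi>.E" and t: "t \<in> {0..1}" for X t
      proof -
        have "cmod (T X t) \<le> sup_norm01 (T X)" by (rule norm_le_sup_norm01[OF T_cont[OF X] t])
        also have "\<dots> \<le> K * luxemburg \<phi> X" by (rule K[OF X])
        also have "\<dots> \<le> max 0 K * luxemburg \<phi> X"
          using \<phi>.luxemburg_nonneg[OF X] by (intro mult_right_mono) auto
        finally show ?thesis .
      qed
    qed (use T in \<open>auto simp: bounded_operator_C01_def\<close>)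
    show ?thesis by (rule extension_exists[OF \<psi> nm b(1) b(3)])
  qed
  ultimately show ?thesis by (simp add: C01_extension_property_def)
qed

context interpolation_strip
begin

lemma quasi_young_Phi: "\<exists>C. quasi_young n (Phi n) C"
proof -
  obtain C where C: "1 \<le> C" "quasiconvex C (Phi n)"
    using Phi_quasiconvex[of n] unfolding quasiconvex_def by blast
  have "quasi_young n (Phi n) C"
    by (rule quasi_young.intro) (rule Phi_nonneg Phi_0 C Phi_scale Phi_coercive)+
  then show ?thesis ..
qed

end

theorem theorem5p1:
  fixes E0 :: endpoint and \<phi>1 :: "complex \<Rightarrow> real" and \<theta> :: real
    and w :: "complex \<Rightarrow> complex" and n m :: nat
  assumes "admissible_endpoint E0"
    and "orlicz \<phi>1" and "nondegenerate \<phi>1" and "Delta2 \<phi>1"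
    and "0 < \<theta>" and "\<theta> < 1"
    and "conformal_strip_map \<theta> w"
    and "1 \<le> n" and "n \<le> m"
  defines "\<Phi> \<equiv> phi_vec (endpoint_inv E0) (orlicz_inv \<phi>1) \<theta> w"
  shows "C01_extension_property
           (fenchel_orlicz n (\<Phi> n)) (luxemburg (\<Phi> n))
           (fenchel_orlicz m (\<Phi> m)) (luxemburg (\<Phi> m))
           (tuple_embed n m)"
proof -
  interpret interpolation_strip "endpoint_inv E0" "orlicz_inv \<phi>1" \<theta> w
    using assms by unfold_locales (auto intro: profile_endpoint_inv doubling_profile_orlicz_inv)
  obtain C C' where C: "quasi_young n (Phi n) C" "quasi_young m (Phi m) C'"
    using quasi_young_Phi by meson
  obtain b where b: "1 \<le> b" "\<And>x. Phi m (shift_up (m - n) m x) \<le> b * Phi n x"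
    "\<And>x. Phi n x \<le> b * Phi m (shift_up (m - n) m x)"
    using Phi_shift[of m n "m - n"] \<open>n \<le> m\<close> unfolding shift_up_def by auto
  show ?thesis
    unfolding \<Phi>_def by (rule quasi_young_C01_extension_property[OF C \<open>n \<le> m\<close> b])
qed

end
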